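(* Let $\Omega,\tilde\Omega\subset\mathbb{R}^n$ be connected open sets with piecewise $C^1$ boundary, and let $\mu$ and $\tilde\mu$ be probability measures on $\Omega$ and $\tilde\Omega$ respectively, with Lebesgue densities positive in $\Omega$ and $\tilde\Omega$ respectively, sharing the same copula. Let $T$ be the Nataf transformation from $\tilde\mu$ to $\mu$, $$T(\tilde x)=(T_1(\tilde x_1),\dots,T_n(\tilde x_n))=\big(F_1^{-1}\circ\tilde F_1(\tilde x_1),\dots,F_n^{-1}\circ\tilde F_n(\tilde x_n)\big),\qquad\tilde x\in\tilde\Omega,$$ where $F_i,\tilde F_i$ are the cumulative distribution functions of the $i$-th marginals of $\mu,\tilde\mu$, with densities $\rho_i,\tilde\rho_i$. Suppose that $\tilde\mu$ satisfies a weighted Poincaré inequality with weight $\tilde W$, with optimal constant $C_P(\tilde\mu,\tilde W)$. Then $\mu$ satisfies the inequality $$\mathrm{Var}_\mu(f)\le C_P(\tilde\mu,\tilde W)\int_\Omega\|D\,\nabla f\|^2_{\tilde W\circ T^{-1}}\,d\mu$$ for all $f\in L^2(\mu)$ for which the right-hand side is finite, where $D$ is the diagonal matrix (depending on $x\in\Omega$) with entries $$D_{i,i}=T_i'\circ T_i^{-1}=\left(\frac{\tilde\rho_i}{\rho_i\circ F_i^{-1}\circ\tilde F_i}\right)\circ T_i^{-1}=\frac{\tilde\rho_i\circ T_i^{-1}}{\rho_i}.$$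
   Context: For a symmetric positive definite matrix $A$, $\|x\|_A=\sqrt{\langle Ax,x\rangle}$. A weight on $\Omega$ is a (measurable) function $W$ from $\Omega$ to the symmetric positive definite $n\times n$ matrices. A probability measure $\mu$ on $\Omega$ satisfies a weighted Poincaré inequality with weight $W$ and finite constant $C>0$ if $$\mathrm{Var}_\mu(f):=\int_\Omega f^2\,d\mu-\Big(\int_\Omega f\,d\mu\Big)^2\le C\int_\Omega\|\nabla f\|_W^2\,d\mu$$ for all $f\in L^2(\mu)$ for which the right-hand side is finite, where $\nabla f$ is the gradient of weak partial derivatives (so $f$ is understood to be weakly differentiable). $C_P(\mu,W)$ denotes the smallest such constant. The copula of $\mu$ is the unique function $\mathcal{C}:[0,1]^n\to[0,1]$ such that $F(x_1,\dots,x_n)=\mathcal{C}(F_1(x_1),\dots,F_n(x_n))$ for all $x\in\mathbb{R}^n$, where $F(x)=\mu\big(\Omega\cap\prod_{i=1}^n(-\infty,x_i)\big)$ is the cumulative distribution function of $\mu$ and $F_i$ that of its $i$-th marginal. The inverse functions $F_i^{-1}$ are taken on the open interval where the $i$-th marginal has positive density. Standing convention: the Nataf transformation $T$ is a diffeomorphism from $\tilde\Omega$ onto $\Omega$, with inverse $T^{-1}(x)=(\tilde F_1^{-1}\circ F_1(x_1),\dots,\tilde F_n^{-1}\circ F_n(x_n))$, $x\in\Omega$. *)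

theory Defs
  imports "HOL-Probability.Probability"
begin

section \<open>Domains with piecewise $C^1$ boundary and diffeomorphisms\<close>

definition C1_map_on ::
    "'a::euclidean_space set \<Rightarrow> ('a \<Rightarrow> 'b::euclidean_space) \<Rightarrow> bool" where
  "C1_map_on U f \<longleftrightarrow>
     (\<exists>f'. (\<forall>x\<in>U. (f has_derivative blinfun_apply (f' x)) (at x)) \<and> continuous_on U f')"

text \<open>A \<open>C1_patch\<close> is a parametrized piece of hypersurface. The parameter domain
  $[0,1]^{n-1}$ is realised as the face $\{x_k = 0\}$ of the unit cube. The parametrization is $C^1$
  up to the boundary of the face; injectivity and maximal rank are required only in the relative
  interior. For \<open>n = 1\<close> a patch is a single point.\<close>

definition C1_patch :: "(real^'n) set \<Rightarrow> bool" where
  "C1_patch P \<longleftrightarrow>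
     (\<exists>(k::'n) (\<gamma> :: real^'n \<Rightarrow> real^'n) U.
        let Q = {x. x $ k = 0 \<and> (\<forall>j. 0 \<le> x $ j \<and> x $ j \<le> 1)};
            Q0 = {x. x $ k = 0 \<and> (\<forall>j. j \<noteq> k \<longrightarrow> 0 < x $ j \<and> x $ j < 1)}
        in open U \<and> Q \<subseteq> U \<and> C1_map_on U \<gamma> \<and> inj_on \<gamma> Q0 \<and>
           (\<forall>x\<in>Q0. inj_on (frechet_derivative \<gamma> (at x)) {v. v $ k = 0}) \<and>
           P = \<gamma> ` Q)"

text \<open>The boundary is locally a finite union of \<open>C1_patch\<close>es; it may be empty or unbounded.\<close>

definition piecewise_C1_boundary :: "(real^'n) set \<Rightarrow> bool" where
  "piecewise_C1_boundary \<Omega> \<longleftrightarrow>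
     (\<forall>p\<in>frontier \<Omega>. \<exists>U PP. open U \<and> p \<in> U \<and> finite PP \<and> (\<forall>P\<in>PP. C1_patch P) \<and>
        frontier \<Omega> \<inter> U \<subseteq> \<Union>PP \<and> \<Union>PP \<subseteq> frontier \<Omega>)"

definition diffeomorphism_with_inverse ::
    "(real^'n) set \<Rightarrow> (real^'n) set \<Rightarrow> (real^'n \<Rightarrow> real^'n) \<Rightarrow> (real^'n \<Rightarrow> real^'n) \<Rightarrow> bool" where
  "diffeomorphism_with_inverse U V T S \<longleftrightarrow>
     homeomorphism U V T S \<and> C1_map_on U T \<and> C1_map_on V S"


section \<open>Weak gradients\<close>

definition partial_deriv :: "'n \<Rightarrow> (real^'n \<Rightarrow> real) \<Rightarrow> real^'n \<Rightarrow> real" where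
  "partial_deriv i f x = frechet_derivative f (at x) (axis i 1)"

primrec C_k :: "nat \<Rightarrow> (real^'n \<Rightarrow> real) \<Rightarrow> bool" where
  "C_k 0 f \<longleftrightarrow> continuous_on UNIV f"
| "C_k (Suc k) f \<longleftrightarrow> (\<forall>x. f differentiable (at x)) \<and> (\<forall>i. C_k k (partial_deriv i f))"

definition test_function_on :: "(real^'n) set \<Rightarrow> (real^'n \<Rightarrow> real) \<Rightarrow> bool" where
  "test_function_on \<Omega> \<phi> \<longleftrightarrow>
     (\<forall>k. C_k k \<phi>) \<and> (\<exists>K. compact K \<and> K \<subseteq> \<Omega> \<and> (\<forall>x. x \<notin> K \<longrightarrow> \<phi> x = 0))"

definition locally_integrable_on :: "(real^'n \<Rightarrow> real) \<Rightarrow> (real^'n) set \<Rightarrow> bool" where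
  "locally_integrable_on f \<Omega> \<longleftrightarrow> (\<forall>K. compact K \<and> K \<subseteq> \<Omega> \<longrightarrow> set_integrable lborel K f)"

definition has_weak_gradient ::
    "(real^'n) set \<Rightarrow> (real^'n \<Rightarrow> real) \<Rightarrow> (real^'n \<Rightarrow> real^'n) \<Rightarrow> bool" where
  "has_weak_gradient \<Omega> f g \<longleftrightarrow>
     locally_integrable_on f \<Omega> \<and>
     (\<forall>i. locally_integrable_on (\<lambda>x. g x $ i) \<Omega> \<and>
        (\<forall>\<phi>. test_function_on \<Omega> \<phi> \<longrightarrow>
           (LINT x:\<Omega>|lborel. f x * partial_deriv i \<phi> x) = - (LINT x:\<Omega>|lborel. g x $ i * \<phi> x)))"


section \<open>Weighted Poincar\'e inequalities\<close>

text \<open>Measures on $\Omega$ live on the Borel subsets of $\Omega$, so \<open>space \<mu> = \<Omega>\<close> and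
  integrals with respect to \<open>\<mu>\<close> are integrals over $\Omega$.\<close>

definition prob_with_positive_density :: "(real^'n) set \<Rightarrow> (real^'n) measure \<Rightarrow> bool" where
  "prob_with_positive_density \<Omega> \<mu> \<longleftrightarrow>
     prob_space \<mu> \<and>
     (\<exists>\<rho>. \<rho> \<in> borel_measurable (restrict_space lborel \<Omega>) \<and> (\<forall>x\<in>\<Omega>. 0 < \<rho> x) \<and>
          \<mu> = density (restrict_space lborel \<Omega>) (\<lambda>x. ennreal (\<rho> x)))"

definition sym_pos_def :: "real^'n^'n \<Rightarrow> bool" where
  "sym_pos_def A \<longleftrightarrow> transpose A = A \<and> (\<forall>x. x \<noteq> 0 \<longrightarrow> 0 < (A *v x) \<bullet> x)"

definition matrix_norm :: "real^'n^'n \<Rightarrow> real^'n \<Rightarrow> real" where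
  "matrix_norm A x = sqrt ((A *v x) \<bullet> x)"

definition weight_on :: "(real^'n) set \<Rightarrow> (real^'n \<Rightarrow> real^'n^'n) \<Rightarrow> bool" where
  "weight_on \<Omega> W \<longleftrightarrow>
     W \<in> borel_measurable (restrict_space borel \<Omega>) \<and> (\<forall>x\<in>\<Omega>. sym_pos_def (W x))"

definition in_L2 :: "'a measure \<Rightarrow> ('a \<Rightarrow> real) \<Rightarrow> bool" where
  "in_L2 \<mu> f \<longleftrightarrow> f \<in> borel_measurable \<mu> \<and> integrable \<mu> (\<lambda>x. (f x)\<^sup>2)"

definition Var :: "'a measure \<Rightarrow> ('a \<Rightarrow> real) \<Rightarrow> real" where
  "Var \<mu> f = (\<integral>x. (f x)\<^sup>2 \<partial>\<mu>) - (\<integral>x. f x \<partial>\<mu>)\<^sup>2"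

text \<open>A weak gradient is Borel on $\Omega$, so finiteness of the right-hand side is integrability.\<close>

definition weighted_poincare ::
    "(real^'n) set \<Rightarrow> (real^'n) measure \<Rightarrow> (real^'n \<Rightarrow> real^'n^'n) \<Rightarrow> real \<Rightarrow> bool" where
  "weighted_poincare \<Omega> \<mu> W C \<longleftrightarrow>
     0 < C \<and>
     (\<forall>f g. in_L2 \<mu> f \<and> has_weak_gradient \<Omega> f g \<and>
            integrable \<mu> (\<lambda>x. (matrix_norm (W x) (g x))\<^sup>2) \<longrightarrow>
        Var \<mu> f \<le> C * (\<integral>x. (matrix_norm (W x) (g x))\<^sup>2 \<partial>\<mu>))"

text \<open>An infimum rather than a least element: if only constants have finite energy (possible for
  a very singular \<open>W\<close>), every \<open>C > 0\<close> is admissible and the value is \<open>0\<close>. In all other cases the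
  infimum is attained.\<close>

definition poincare_const ::
    "(real^'n) set \<Rightarrow> (real^'n) measure \<Rightarrow> (real^'n \<Rightarrow> real^'n^'n) \<Rightarrow> real" where
  "poincare_const \<Omega> \<mu> W = Inf {C. weighted_poincare \<Omega> \<mu> W C}"


section \<open>Copulas and the Nataf transformation\<close>

text \<open>Both distribution functions use open half-lines, unlike \<^const>\<open>cdf\<close>; for measures with
  Lebesgue densities this makes no difference.\<close>

definition joint_cdf :: "(real^'n) measure \<Rightarrow> real^'n \<Rightarrow> real" where
  "joint_cdf \<mu> x = measure \<mu> (space \<mu> \<inter> {y. \<forall>i. y $ i < x $ i})"

definition marginal_cdf :: "(real^'n) measure \<Rightarrow> 'n \<Rightarrow> real \<Rightarrow> real" where
  "marginal_cdf \<mu> i t = measure (distr \<mu> borel (\<lambda>x. x $ i)) {..<t}"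

definition is_copula_of :: "(real^'n \<Rightarrow> real) \<Rightarrow> (real^'n) measure \<Rightarrow> bool" where
  "is_copula_of C \<mu> \<longleftrightarrow>
     (\<forall>u. (\<forall>i. u $ i \<in> {0..1}) \<longrightarrow> C u \<in> {0..1}) \<and>
     (\<forall>x. joint_cdf \<mu> x = C (\<chi> i. marginal_cdf \<mu> i (x $ i)))"

definition same_copula :: "(real^'n) measure \<Rightarrow> (real^'n) measure \<Rightarrow> bool" where
  "same_copula \<mu> \<nu> \<longleftrightarrow> (\<exists>C. is_copula_of C \<mu> \<and> is_copula_of C \<nu>)"

text \<open>Densities are determined up to null sets only; as usual a version is chosen which is
  positive exactly on an open interval. For a measure with positive density on a connected
  open $\Omega$ such a version exists, and the interval is the projection of $\Omega$.\<close>

definition marginal_densities :: "(real^'n) measure \<Rightarrow> ('n \<Rightarrow> real \<Rightarrow> real) \<Rightarrow> bool" where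
  "marginal_densities \<mu> \<rho> \<longleftrightarrow>
     (\<forall>i. distributed \<mu> lborel (\<lambda>x. x $ i) (\<lambda>t. ennreal (\<rho> i t)) \<and>
          \<rho> i \<in> borel_measurable borel \<and> (\<forall>t. 0 \<le> \<rho> i t) \<and>
          open {t. 0 < \<rho> i t} \<and> is_interval {t. 0 < \<rho> i t})"

text \<open>$F_i^{-1}$, taken on the interval where \<open>\<rho> i\<close> is positive.\<close>

definition marginal_cdf_inv ::
    "(real^'n) measure \<Rightarrow> ('n \<Rightarrow> real \<Rightarrow> real) \<Rightarrow> 'n \<Rightarrow> real \<Rightarrow> real" where
  "marginal_cdf_inv \<mu> \<rho> i = inv_into {t. 0 < \<rho> i t} (marginal_cdf \<mu> i)"

text \<open>The Nataf transformation from \<open>\<nu>\<close> to \<open>\<mu>\<close>, where \<open>\<rho>\<close> are the marginal densities of \<open>\<mu>\<close>.\<close>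

definition nataf_coord ::
    "(real^'n) measure \<Rightarrow> (real^'n) measure \<Rightarrow> ('n \<Rightarrow> real \<Rightarrow> real) \<Rightarrow> 'n \<Rightarrow> real \<Rightarrow> real" where
  "nataf_coord \<nu> \<mu> \<rho> i = marginal_cdf_inv \<mu> \<rho> i \<circ> marginal_cdf \<nu> i"

definition nataf ::
    "(real^'n) measure \<Rightarrow> (real^'n) measure \<Rightarrow> ('n \<Rightarrow> real \<Rightarrow> real) \<Rightarrow> real^'n \<Rightarrow> real^'n" where
  "nataf \<nu> \<mu> \<rho> x = (\<chi> i. nataf_coord \<nu> \<mu> \<rho> i (x $ i))"

text \<open>The matrix with diagonal entries $T_i' \circ T_i^{-1}$, for \<open>T = nataf \<nu> \<mu> \<rho>\<close> with inverse
  \<open>nataf \<mu> \<nu> \<sigma>\<close>; here \<open>\<sigma>\<close> are the marginal densities of \<open>\<nu>\<close>.\<close>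

definition nataf_diag ::
    "(real^'n) measure \<Rightarrow> ('n \<Rightarrow> real \<Rightarrow> real) \<Rightarrow> (real^'n) measure \<Rightarrow> ('n \<Rightarrow> real \<Rightarrow> real) \<Rightarrow>
     real^'n \<Rightarrow> real^'n^'n" where
  "nataf_diag \<nu> \<sigma> \<mu> \<rho> x =
     (\<chi> i j. if i = j then deriv (nataf_coord \<nu> \<mu> \<rho> i) (nataf_coord \<mu> \<nu> \<sigma> i (x $ i)) else 0)"

end

theory Submission
  imports Defs
begin

text \<open>
  The Nataf transformation \<open>T\<close> acts on each coordinate separately and maps \<open>\<mu>'\<close> to \<open>\<mu>\<close>. Hence
  \<open>f\<close> and \<open>f \<circ> T\<close> have the same variance under \<open>\<mu>\<close> and \<open>\<mu>'\<close>, and the weighted Poincar\'e inequality of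
  \<open>\<mu>'\<close> for \<open>f \<circ> T\<close> becomes the asserted inequality for \<open>f\<close> once the weak gradient of \<open>f \<circ> T\<close> is known
  to be the diagonal Jacobian of \<open>T\<close> times the weak gradient of \<open>f\<close> along \<open>T\<close>
  (\<open>weighted_poincare_transport\<close>). The inequality then holds for all admissible constants, and so for
  their infimum (\<open>le_poincare_const_mult\<close>).

  That \<open>T\<close> maps \<open>\<mu>'\<close> to \<open>\<mu>\<close> (\<open>distr_T\<close>) is what the copula is for: the coordinates of \<open>T\<close> preserve the levels
  of the marginal distribution functions, and a joint distribution function is determined by these
  levels and the copula.

  The chain rule for weak gradients (\<open>has_weak_gradient_compose\<close>) needs care because \<open>T\<close> is
  only $C^1$. Substitution turns the integral of \<open>(f \<circ> T) * \<partial>\<^sub>i\<phi>\<close> for a test function \<open>\<phi>\<close> into an integral of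
  \<open>f\<close> against \<open>\<partial>\<^sub>i\<phi>\<close> along the inverse \<open>S\<close> of \<open>T\<close>, times the Jacobian of \<open>S\<close>. The latter is a product of
  functions of one coordinate each, so the integrand is \<open>f\<close> times the \<open>i\<close>-th partial derivative of a
  compactly supported function that is continuous and continuously differentiable in the \<open>i\<close>-th
  direction, but in general no better than continuous in the others. Such functions are admissible in
  the definition of the weak gradient (\<open>weak_gradient_nonsmooth_test\<close>), since test functions
  approximate them uniformly together with their \<open>i\<close>-th partial derivative
  (\<open>test_function_approximation\<close>).

  The formulas for the diagonal entries compare two densities of the same marginal
  (\<open>marginal_density_transport\<close>), which agree almost everywhere.
\<close>

section \<open>Smooth functions\<close>

lemma partial_deriv_eq:
  assumes "(f has_derivative f') (at x)"
  shows "partial_deriv i f x = f' (axis i 1)"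
  using frechet_derivative_at[OF assms] by (simp add: partial_deriv_def)

lemma C_k_SucD: "C_k (Suc k) f \<Longrightarrow> C_k k f"
proof (induction k arbitrary: f)
  case 0
  then have "\<forall>x. f differentiable (at x)" by simp
  then show ?case
    by (simp add: continuous_at_imp_continuous_on differentiable_imp_continuous_within)
next
  case (Suc k)
  then show ?case by (metis C_k.simps(2))
qed

lemma C_k_const: "C_k k (\<lambda>x :: real^'n. c)"
proof (induction k arbitrary: c)
  case (Suc k)
  have "partial_deriv i (\<lambda>x :: real^'n. c) = (\<lambda>x. 0)" for i
    by (rule ext, subst partial_deriv_eq[OF has_derivative_const]) simp
  with Suc show ?case by simp
qed simp

lemma C_k_bounded_linear:
  assumes "bounded_linear f"
  shows "C_k k f"
proof (cases k)
  case 0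
  then show ?thesis using assms by (simp add: linear_continuous_on)
next
  case (Suc m)
  have "partial_deriv i f = (\<lambda>x. f (axis i 1))" for i
    by (rule ext, rule partial_deriv_eq) (rule bounded_linear_imp_has_derivative[OF assms])
  then show ?thesis
    using Suc bounded_linear_imp_differentiable[OF assms] by (simp add: C_k_const)
qed

lemma partial_deriv_add:
  assumes "f differentiable (at x)" "g differentiable (at x)"
  shows "partial_deriv i (\<lambda>x. f x + g x) x = partial_deriv i f x + partial_deriv i g x"
  by (subst partial_deriv_eq[OF has_derivative_add[OF assms[unfolded frechet_derivative_works]]])
    (simp add: partial_deriv_def)

lemma partial_deriv_mult:
  assumes "f differentiable (at x)" "g differentiable (at x)"
  shows "partial_deriv i (\<lambda>x. f x * g x) x = f x * partial_deriv i g x + partial_deriv i f x * g x"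
  by (subst partial_deriv_eq[OF has_derivative_mult[OF assms[unfolded frechet_derivative_works]]])
    (simp add: partial_deriv_def)

lemma C_k_add: "C_k k f \<Longrightarrow> C_k k g \<Longrightarrow> C_k k (\<lambda>x. f x + g x)"
proof (induction k arbitrary: f g)
  case 0
  then show ?case by (auto intro: continuous_intros)
next
  case (Suc k)
  then have "partial_deriv i (\<lambda>x. f x + g x) = (\<lambda>x. partial_deriv i f x + partial_deriv i g x)" for i
    by (auto simp: partial_deriv_add)
  with Suc show ?case by (auto intro!: derivative_intros)
qed

lemma C_k_mult: "C_k k f \<Longrightarrow> C_k k g \<Longrightarrow> C_k k (\<lambda>x. f x * g x)"
proof (induction k arbitrary: f g)
  case 0
  then show ?case by (auto intro: continuous_intros)
next
  case (Suc k)
  then have "partial_deriv i (\<lambda>x. f x * g x)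
      = (\<lambda>x. f x * partial_deriv i g x + partial_deriv i f x * g x)" for i
    by (auto simp: partial_deriv_mult)
  moreover have "C_k k f" "C_k k g" using Suc.prems by (blast intro: C_k_SucD)+
  ultimately show ?case using Suc by (auto intro!: derivative_intros C_k_add)
qed

lemma C_k_diff: "C_k k f \<Longrightarrow> C_k k g \<Longrightarrow> C_k k (\<lambda>x. f x - g x)"
  using C_k_add[of k f "\<lambda>x. - 1 * g x"] C_k_mult[OF C_k_const[of k "-1"], of g] by simp

lemma C_k_sum: "(\<And>j. j \<in> A \<Longrightarrow> C_k k (f j)) \<Longrightarrow> C_k k (\<lambda>x. \<Sum>j\<in>A. f j x)"
  by (induction A rule: infinite_finite_induct) (auto intro: C_k_add simp: C_k_const)

lemma C_k_prod: "(\<And>j. j \<in> A \<Longrightarrow> C_k k (f j)) \<Longrightarrow> C_k k (\<lambda>x. \<Prod>j\<in>A. f j x)"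
  by (induction A rule: infinite_finite_induct) (auto intro: C_k_mult simp: C_k_const)

lemma C_k_real_polynomial_function: "real_polynomial_function p \<Longrightarrow> C_k k p"
  by (induction p rule: real_polynomial_function.induct)
    (auto intro: C_k_bounded_linear C_k_const C_k_add C_k_mult)

text \<open>The function of interest is \<open>flat_exp 0\<close>, which is $e^{-1/t}$ continued by $0$ to $t \le 0$. The
  parameter \<open>m\<close> makes the span of the family closed under differentiation, so that smoothness
  follows by one induction over the order.\<close>

definition flat_exp :: "nat \<Rightarrow> real \<Rightarrow> real" where
  "flat_exp m t = (if t \<le> 0 then 0 else exp (- inverse t) * inverse t ^ m)"

lemma flat_exp_tendsto_0: "(flat_exp m \<longlongrightarrow> 0) (at 0)"
proof -
  have "(((\<lambda>u. u ^ m / exp u) \<circ> inverse) \<longlongrightarrow> (0::real)) (at_right 0)"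
    unfolding comp_def
    by (rule filterlim_compose[OF tendsto_power_div_exp_0 filterlim_inverse_at_top_right])
  moreover have "eventually (\<lambda>t. ((\<lambda>u. u ^ m / exp u) \<circ> inverse) t = flat_exp m t) (at_right 0)"
    by (rule eventually_at_right_less[THEN eventually_mono])
      (auto simp: flat_exp_def exp_minus field_simps)
  ultimately have "(flat_exp m \<longlongrightarrow> 0) (at_right 0)"
    by (rule Lim_transform_eventually)
  moreover have "(flat_exp m \<longlongrightarrow> 0) (at_left 0)"
    by (rule Lim_transform_eventually[OF tendsto_const])
      (auto simp: flat_exp_def eventually_at_filter)
  ultimately show ?thesis by (simp add: filterlim_split_at)
qed

lemma flat_exp_has_derivative:
  "(flat_exp m has_real_derivative (flat_exp (m + 2) t - real m * flat_exp (m + 1) t)) (at t)"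
proof -
  consider "t < 0" | "t = 0" | "t > 0" by linarith
  then show ?thesis
  proof cases
    case 1
    have "(flat_exp m has_real_derivative 0) (at t)"
      by (rule has_field_derivative_transform_within_open[OF DERIV_const[of 0], of "{..<0}"])
        (use 1 in \<open>auto simp: flat_exp_def\<close>)
    with 1 show ?thesis by (simp add: flat_exp_def)
  next
    case 2
    have "eventually (\<lambda>h. flat_exp (m + 1) h = (flat_exp m (0 + h) - flat_exp m 0) / h) (at 0)"
      by (auto simp: flat_exp_def eventually_at_filter field_simps)
    from Lim_transform_eventually[OF flat_exp_tendsto_0 this] have "DERIV (flat_exp m) 0 :> 0"
      by (simp add: DERIV_def)
    with 2 show ?thesis by (simp add: flat_exp_def)
  next
    case 3
    have "((\<lambda>t. exp (- inverse t) * inverse t ^ m) has_real_derivative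
        (flat_exp (m + 2) t - real m * flat_exp (m + 1) t)) (at t)"
      apply (rule derivative_eq_intros refl | (use 3 in simp; fail))+
      using 3 by (cases m) (simp_all add: flat_exp_def field_simps power2_eq_square)
    then show ?thesis
      by (rule has_field_derivative_transform_within_open[of _ _ _ "{0<..}"])
        (use 3 in \<open>auto simp: flat_exp_def\<close>)
  qed
qed

lemma C_k_flat_exp: "C_k k (\<lambda>x :: real^'n. flat_exp m (c * x $ j + a))"
proof (induction k arbitrary: m)
  case 0
  have "continuous_on UNIV (flat_exp m)"
    by (rule DERIV_continuous_on[OF flat_exp_has_derivative[THEN DERIV_subset]]) simp
  then show ?case
    by (auto intro!: continuous_intros continuous_on_compose2[of UNIV "flat_exp m"])
next
  case (Suc k)
  let ?d = "\<lambda>x :: real^'n. flat_exp (m + 2) (c * x $ j + a) - real m * flat_exp (m + 1) (c * x $ j + a)"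
  have D: "((\<lambda>x. flat_exp m (c * x $ j + a)) has_derivative (\<lambda>h. ?d x * (c * h $ j))) (at x)" for x :: "real^'n"
    by (rule has_derivative_compose[OF _ flat_exp_has_derivative[unfolded has_field_derivative_def]])
      (auto intro!: derivative_eq_intros bounded_linear_imp_has_derivative[OF bounded_linear_vec_nth])
  have "partial_deriv i (\<lambda>x. flat_exp m (c * x $ j + a)) = (\<lambda>x. (flat_exp (m + 2) (c * x $ j + a)
      - real m * flat_exp (m + 1) (c * x $ j + a)) * (c * axis i 1 $ j))" for i
    by (rule ext, subst partial_deriv_eq[OF D]) simp
  moreover have "(\<lambda>x :: real^'n. flat_exp m (c * x $ j + a)) differentiable (at x)" for x
    using D by (auto simp: differentiable_def)
  ultimately show ?case
    using Suc by (auto intro!: C_k_diff C_k_mult C_k_const)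
qed

text \<open>By compactness finitely many open boxes with closure in \<open>\<Omega>\<close> cover \<open>K\<close>; the function is the sum
  of the smooth bumps \<open>\<Prod>j. flat_exp 0 (x\<^sub>j - a\<^sub>j) * flat_exp 0 (b\<^sub>j - x\<^sub>j)\<close>, each of which is positive
  exactly on its box.\<close>

lemma test_function_positive_on_compact:
  fixes \<Omega> :: "(real^'n) set"
  assumes "open \<Omega>" "compact K" "K \<subseteq> \<Omega>"
  obtains \<kappa> where "test_function_on \<Omega> \<kappa>" "\<And>x. 0 \<le> \<kappa> x" "\<And>x. x \<in> K \<Longrightarrow> 0 < \<kappa> x"
proof -
  define bump :: "(real^'n) \<times> (real^'n) \<Rightarrow> real^'n \<Rightarrow> real" where
    "bump = (\<lambda>(a, b) x. \<Prod>j\<in>UNIV. flat_exp 0 (1 * x $ j + (- a $ j)) * flat_exp 0 ((-1) * x $ j + b $ j))"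
  have bump_nonneg: "0 \<le> bump ab x" for ab x
    by (auto simp: bump_def flat_exp_def split: prod.splits intro!: prod_nonneg)
  have bump_pos: "0 < bump (a, b) x \<longleftrightarrow> x \<in> box a b" for a b x
  proof
    assume "0 < bump (a, b) x"
    then have "flat_exp 0 (1 * x $ j + (- a $ j)) * flat_exp 0 ((-1) * x $ j + b $ j) \<noteq> 0" for j
      by (subst (asm) less_le) (simp add: bump_def)
    then show "x \<in> box a b" by (auto simp: mem_box_cart flat_exp_def split: if_splits) (meson not_le)+
  next
    assume "x \<in> box a b"
    then show "0 < bump (a, b) x"
      by (auto simp: bump_def mem_box_cart flat_exp_def not_le intro!: prod_pos)
  qed
  have bump_smooth: "C_k k (bump ab)" for k ab
  proof (cases ab)
    case (Pair a b)
    have "C_k k (\<lambda>x. flat_exp 0 (1 * x $ j + (- a $ j)) * flat_exp 0 ((-1) * x $ j + b $ j))" for j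
      by (rule C_k_mult[OF C_k_flat_exp[of k 0 1 j "- a $ j"] C_k_flat_exp[of k 0 "-1" j "b $ j"]])
    then have "C_k k (\<lambda>x. \<Prod>j\<in>UNIV. flat_exp 0 (1 * x $ j + (- a $ j)) * flat_exp 0 ((-1) * x $ j + b $ j))"
      by (rule C_k_prod)
    then show ?thesis by (simp only: bump_def Pair prod.case)
  qed
  define \<B> where "\<B> = {(a, b). cbox a b \<subseteq> \<Omega>}"
  have "K \<subseteq> (\<Union>(a, b)\<in>\<B>. box a b)"
  proof
    fix x assume "x \<in> K"
    then have "x \<in> \<Omega>" using assms(3) by blast
    then obtain a b where "cbox a b \<subseteq> \<Omega>" "x \<in> box a b"
      by (rule open_contains_cbox[OF assms(1)])
    then show "x \<in> (\<Union>(a, b)\<in>\<B>. box a b)" by (auto simp: \<B>_def)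
  qed
  then have cover: "K \<subseteq> (\<Union>ab\<in>\<B>. case ab of (a, b) \<Rightarrow> box a b)" by simp
  have opn: "open (case ab of (a, b) \<Rightarrow> box a b)" for ab :: "(real^'n) \<times> (real^'n)"
    by (cases ab) (simp add: open_box)
  obtain \<F> where \<F>: "\<F> \<subseteq> \<B>" "finite \<F>" "K \<subseteq> (\<Union>(a, b)\<in>\<F>. box a b)"
    by (rule compactE_image[OF assms(2) opn cover])
  define \<kappa> where "\<kappa> x = (\<Sum>ab\<in>\<F>. bump ab x)" for x
  show thesis
  proof
    show "0 \<le> \<kappa> x" for x unfolding \<kappa>_def by (intro sum_nonneg bump_nonneg)
    show "0 < \<kappa> x" if x: "x \<in> K" for x
    proof -
      obtain a b where ab: "(a, b) \<in> \<F>" "x \<in> box a b" using \<F>(3) x by auto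
      have "0 < bump (a, b) x" using bump_pos ab(2) by blast
      with \<F>(2) ab(1) show ?thesis
        unfolding \<kappa>_def by (rule sum_pos2) (rule bump_nonneg)
    qed
    show "test_function_on \<Omega> \<kappa>"
      unfolding test_function_on_def
    proof (intro conjI exI allI impI)
      show "C_k k \<kappa>" for k unfolding \<kappa>_def by (intro C_k_sum bump_smooth)
      show "compact (\<Union>(a, b)\<in>\<F>. cbox a b)" using \<F>(2) by (auto intro!: compact_UN compact_cbox)
      show "(\<Union>(a, b)\<in>\<F>. cbox a b) \<subseteq> \<Omega>" using \<F>(1) by (auto simp: \<B>_def)
      fix x assume x: "x \<notin> (\<Union>(a, b)\<in>\<F>. cbox a b)"
      show "\<kappa> x = 0" unfolding \<kappa>_def
      proof (intro sum.neutral ballI)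
        fix ab assume "ab \<in> \<F>"
        then obtain a b where ab: "ab = (a, b)" "x \<notin> cbox a b" using x by (cases ab) auto
        then have "\<not> 0 < bump ab x" using box_subset_cbox[of a b] by (simp add: bump_pos) blast
        with bump_nonneg[of ab x] show "bump ab x = 0" by simp
      qed
    qed
  qed
qed

section \<open>Weak gradients against test functions of low regularity\<close>

definition has_partial :: "'n \<Rightarrow> (real^'n \<Rightarrow> real) \<Rightarrow> real \<Rightarrow> real^'n \<Rightarrow> bool" where
  "has_partial i f D x \<longleftrightarrow> ((\<lambda>t. f (x + t *\<^sub>R axis i 1)) has_real_derivative D) (at 0)"

lemma has_partial_along_line:
  assumes "has_partial i f D (x + s *\<^sub>R axis i 1)"
  shows "((\<lambda>t. f (x + t *\<^sub>R axis i 1)) has_real_derivative D) (at s)"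
proof -
  have "((\<lambda>t. f (x + (s + t) *\<^sub>R axis i 1)) has_real_derivative D) (at 0)"
    using assms by (simp add: has_partial_def scaleR_add_left add.assoc)
  then show ?thesis using DERIV_shift[of "\<lambda>t. f (x + t *\<^sub>R axis i 1)" D 0 s]
    by (simp add: add.commute)
qed

lemma has_partial_differentiable:
  assumes "f differentiable (at x)"
  shows "has_partial i f (partial_deriv i f x) x"
proof -
  have 1: "((\<lambda>t. x + t *\<^sub>R axis i 1) has_derivative (\<lambda>t. t *\<^sub>R axis i 1)) (at 0)"
    by (auto intro!: derivative_eq_intros)
  have 2: "(f has_derivative frechet_derivative f (at x)) (at (x + 0 *\<^sub>R axis i 1))"
    using assms by (simp add: frechet_derivative_works)
  have "((\<lambda>t. f (x + t *\<^sub>R axis i 1)) has_derivative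
      (\<lambda>t. frechet_derivative f (at x) (t *\<^sub>R axis i 1))) (at 0)"
    by (rule has_derivative_compose[OF 1 2])
  moreover have "linear (frechet_derivative f (at x))"
    using assms by (simp add: linear_frechet_derivative)
  ultimately show ?thesis
    by (simp add: has_partial_def has_field_derivative_def partial_deriv_def linear_cmul mult.commute)
      (simp add: mult_commute_abs)
qed

lemma partial_deriv_unique:
  assumes "f differentiable (at x)" "has_partial i f D x"
  shows "partial_deriv i f x = D"
  using has_partial_differentiable[OF assms(1)] assms(2) by (auto simp: has_partial_def intro: DERIV_unique)

lemma has_partial_zero_open:
  assumes "open U" "x \<in> U" "\<And>y. y \<in> U \<Longrightarrow> f y = 0"
  shows "has_partial i f 0 x"
proof -
  have "open ((\<lambda>t. x + t *\<^sub>R axis i 1) -` U)"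
    by (intro open_vimage assms continuous_intros)
  then show ?thesis
    unfolding has_partial_def
    by (rule has_field_derivative_transform_within_open[OF DERIV_const[of 0]]) (use assms in auto)
qed

lemma has_partial_unique: "has_partial i f D x \<Longrightarrow> has_partial i f E x \<Longrightarrow> D = E"
  by (auto simp: has_partial_def intro: DERIV_unique)

text \<open>A real polynomial is a combination of terms \<open>c * (x\<^sub>i + R)\<^sup>k\<close> with \<open>c\<close> independent of
  \<open>x\<^sub>i\<close>, and such a term has an obvious primitive that vanishes for \<open>x\<^sub>i = - R\<close>. The proof follows the
  inductive construction of polynomials without computing this normal form: multiplication with a
  polynomial preserves the class of those \<open>f\<close> for which all \<open>c * f * (x\<^sub>i + R)\<^sup>k\<close> have such
  primitives, and this class contains the constant \<open>1\<close>.\<close>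

lemma real_polynomial_function_primitive:
  fixes p :: "real^'n \<Rightarrow> real"
  assumes "real_polynomial_function p"
  obtains q where "real_polynomial_function q" "\<And>x. has_partial i q (p x) x"
    "\<And>x. x $ i = - R \<Longrightarrow> q x = 0"
proof -
  define Prim where "Prim f \<longleftrightarrow> (\<exists>q. real_polynomial_function q \<and> (\<forall>x. has_partial i q (f x) x) \<and>
    (\<forall>x. x $ i = - R \<longrightarrow> q x = 0))" for f :: "real^'n \<Rightarrow> real"
  define indep where "indep c \<longleftrightarrow> real_polynomial_function c \<and> (\<forall>x t. c (x + t *\<^sub>R axis i 1) = c x)"
    for c :: "real^'n \<Rightarrow> real"
  define D where "D = {f. \<forall>c k. indep c \<longrightarrow> Prim (\<lambda>x. c x * f x * (x $ i + R) ^ k)}"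
  have coord: "real_polynomial_function (\<lambda>x :: real^'n. x $ j)" for j
    by (rule real_polynomial_function.intros(1)[OF bounded_linear_vec_nth])
  have Prim_add: "Prim (\<lambda>x. f x + g x)" if fg: "Prim f" "Prim g" for f g
  proof -
    obtain q r where "real_polynomial_function q" "\<forall>x. has_partial i q (f x) x" "\<forall>x. x $ i = - R \<longrightarrow> q x = 0"
      "real_polynomial_function r" "\<forall>x. has_partial i r (g x) x" "\<forall>x. x $ i = - R \<longrightarrow> r x = 0"
      using fg unfolding Prim_def by blast
    then show ?thesis
      unfolding Prim_def has_partial_def
      by (intro exI[of _ "\<lambda>x. q x + r x"]) (auto intro!: DERIV_add)
  qed
  have D_one: "(\<lambda>x. 1) \<in> D"
    unfolding D_def
  proof clarsimp
    fix c k assume c: "indep c"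
    let ?q = "\<lambda>x. c x * ((x $ i + R) ^ Suc k * (1 / (1 + real k)))"
    have "has_partial i ?q (c x * (x $ i + R) ^ k) x" for x
    proof -
      have "((\<lambda>t. c x * ((x $ i + t + R) ^ Suc k * (1 / (1 + real k)))) has_real_derivative
          c x * (x $ i + R) ^ k) (at 0)"
        by (auto intro!: derivative_eq_intros simp del: power_Suc)
      moreover have "c (x + t *\<^sub>R axis i 1) = c x" for t
        using c by (simp add: indep_def)
      ultimately show ?thesis by (simp add: has_partial_def del: power_Suc)
    qed
    moreover have "real_polynomial_function ?q"
      using c unfolding indep_def
      by (intro real_polynomial_function.intros(2-4) real_polynomial_function_power coord) simp
    ultimately show "Prim (\<lambda>x. c x * (x $ i + R) ^ k)"
      unfolding Prim_def by (intro exI[of _ ?q]) auto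
  qed
  have D_mult: "\<forall>f\<in>D. (\<lambda>x. f x * p x) \<in> D"
    using assms
  proof (induction p rule: real_polynomial_function.induct)
    case (linear l)
    interpret bounded_linear l by fact
    show ?case
    proof
      fix f assume f: "f \<in> D"
      \<comment> \<open>split \<open>l\<close> into its value at the projection to the hyperplane \<open>x\<^sub>i = -R\<close> and the rest\<close>
      let ?l0 = "\<lambda>x. l x - l (axis i 1) * (x $ i + R)"
      show "(\<lambda>x. f x * l x) \<in> D"
        unfolding D_def
      proof clarify
        fix c k assume c: "indep c"
        have rpf: "real_polynomial_function ?l0"
          by (intro real_polynomial_function_diff real_polynomial_function.intros(2-4) coord
              real_polynomial_function.intros(1)[OF bounded_linear_axioms])
        have "?l0 (x + t *\<^sub>R axis i 1) = ?l0 x" for x t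
          by (simp add: add scaleR algebra_simps)
        with rpf c have "indep (\<lambda>x. c x * ?l0 x)" by (auto simp: indep_def)
        moreover have "indep (\<lambda>x. c x * l (axis i 1))" using c by (auto simp: indep_def)
        ultimately have "Prim (\<lambda>x. (c x * ?l0 x) * f x * (x $ i + R) ^ k)"
          "Prim (\<lambda>x. (c x * l (axis i 1)) * f x * (x $ i + R) ^ Suc k)"
          using f unfolding D_def by blast+
        from Prim_add[OF this] show "Prim (\<lambda>x. c x * (f x * l x) * (x $ i + R) ^ k)"
          by (simp add: algebra_simps)
      qed
    qed
  next
    case (const a)
    show ?case
    proof
      fix f assume f: "f \<in> D"
      show "(\<lambda>x. f x * a) \<in> D"
        unfolding D_def
      proof clarify
        fix c k assume "indep c"
        then have "indep (\<lambda>x. c x * a)" by (auto simp: indep_def)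
        with f have "Prim (\<lambda>x. (c x * a) * f x * (x $ i + R) ^ k)" unfolding D_def by blast
        then show "Prim (\<lambda>x. c x * (f x * a) * (x $ i + R) ^ k)" by (simp add: mult_ac)
      qed
    qed
  next
    case (add p q)
    show ?case
    proof
      fix f assume f: "f \<in> D"
      show "(\<lambda>x. f x * (p x + q x)) \<in> D"
        unfolding D_def
      proof clarify
        fix c k assume c: "indep c"
        have "Prim (\<lambda>x. c x * (f x * p x) * (x $ i + R) ^ k)"
          "Prim (\<lambda>x. c x * (f x * q x) * (x $ i + R) ^ k)"
          using add.IH f c unfolding D_def by blast+
        from Prim_add[OF this] show "Prim (\<lambda>x. c x * (f x * (p x + q x)) * (x $ i + R) ^ k)"
          by (simp add: algebra_simps)
      qed
    qed
  next
    case (mult p q)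
    then show ?case by (auto simp: mult.assoc[symmetric])
  qed
  have "(\<lambda>x. 1 * p x) \<in> D" using bspec[OF D_mult D_one] by simp
  moreover have "indep (\<lambda>x. 1)" by (auto simp: indep_def)
  ultimately have "Prim (\<lambda>x. 1 * (1 * p x) * (x $ i + R) ^ 0)" unfolding D_def by blast
  then show thesis using that by (auto simp: Prim_def)
qed

lemma continuous_partial_deriv_C_k: "(\<And>k. C_k k f) \<Longrightarrow> continuous_on UNIV (partial_deriv i f)"
  by (drule meta_spec[of _ "Suc 0"]) simp

lemma C_k_differentiable: "(\<And>k. C_k k f) \<Longrightarrow> f differentiable (at x)"
  by (drule meta_spec[of _ "Suc 0"]) simp

text \<open>Polynomials are dense but lack compact support. Therefore \<open>w\<close> is divided by a test function \<open>\<kappa>\<close>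
  that is positive on the support of \<open>w\<close>, the \<open>i\<close>-th partial derivative of the quotient is
  approximated on a cube by a polynomial \<open>p\<close> (Stone-Weierstrass), and \<open>\<phi> = \<kappa> * q\<close> for a primitive \<open>q\<close>
  of \<open>p\<close>. Uniform closeness of the derivatives entails that of the functions, since both \<open>w / \<kappa>\<close> and
  \<open>q\<close> vanish on one face of the cube.\<close>

lemma test_function_approximation:
  fixes \<Omega> :: "(real^'n) set"
  assumes "open \<Omega>" "compact K" "K \<subseteq> \<Omega>"
    and w_cont: "continuous_on UNIV w" and w_supp: "\<And>x. x \<notin> K \<Longrightarrow> w x = 0"
    and w_partial: "\<And>x. has_partial i w (h x) x" and h_cont: "continuous_on UNIV h"
  obtains L where "compact L" "L \<subseteq> \<Omega>" "K \<subseteq> L"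
    "\<And>\<epsilon>. 0 < \<epsilon> \<Longrightarrow> \<exists>\<phi>. test_function_on \<Omega> \<phi> \<and> (\<forall>x. x \<notin> L \<longrightarrow> \<phi> x = 0 \<and> partial_deriv i \<phi> x = 0) \<and>
        (\<forall>x. \<bar>w x - \<phi> x\<bar> \<le> \<epsilon> \<and> \<bar>h x - partial_deriv i \<phi> x\<bar> \<le> \<epsilon>)"
proof -
  obtain \<kappa> where \<kappa>: "test_function_on \<Omega> \<kappa>" "\<And>x. 0 \<le> \<kappa> x" "\<And>x. x \<in> K \<Longrightarrow> 0 < \<kappa> x"
    using test_function_positive_on_compact[OF assms(1-3)] by blast
  then obtain L where L: "compact L" "L \<subseteq> \<Omega>" "\<And>x. x \<notin> L \<Longrightarrow> \<kappa> x = 0" and \<kappa>_smooth: "\<And>k. C_k k \<kappa>"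
    unfolding test_function_on_def by blast
  have KL: "K \<subseteq> L" using L(3) \<kappa>(3) by force
  let ?\<kappa>' = "partial_deriv i \<kappa>"
  have \<kappa>_diff: "\<kappa> differentiable (at x)" for x by (rule C_k_differentiable[OF \<kappa>_smooth])
  have \<kappa>_cont: "continuous_on UNIV \<kappa>" using \<kappa>_smooth[of 0] by simp
  have \<kappa>'_cont: "continuous_on UNIV ?\<kappa>'" by (rule continuous_partial_deriv_C_k[OF \<kappa>_smooth])
  have \<kappa>_partial: "has_partial i \<kappa> (?\<kappa>' x) x" for x by (rule has_partial_differentiable[OF \<kappa>_diff])
  have \<kappa>'_supp: "?\<kappa>' x = 0" if "x \<notin> L" for x
    by (rule partial_deriv_unique[OF \<kappa>_diff has_partial_zero_open[of "- L"]])
      (use that L compact_imp_closed[OF L(1)] in auto)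
  have h_supp: "h x = 0" if "x \<notin> K" for x
    by (rule has_partial_unique[OF w_partial has_partial_zero_open[of "- K"]])
      (use that assms compact_imp_closed[OF assms(2)] in auto)

  \<comment> \<open>the quotient \<open>\<Theta> = w / \<kappa>\<close> and its partial derivative; division by zero gives \<open>0\<close>\<close>
  define \<Theta> where "\<Theta> x = w x / \<kappa> x" for x
  define H where "H x = (h x * \<kappa> x - w x * ?\<kappa>' x) / (\<kappa> x * \<kappa> x)" for x
  have split_UNIV: "UNIV = {x. 0 < \<kappa> x} \<union> - K" using \<kappa>(3) by auto
  have op: "open {x. 0 < \<kappa> x}" "open (- K)"
    using \<kappa>_cont assms(2) compact_imp_closed by (auto intro: open_Collect_less simp: open_Compl)
  have \<Theta>_partial: "has_partial i \<Theta> (H x) x" for x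
  proof (cases "x \<in> K")
    case True
    then have "\<kappa> (x + 0 *\<^sub>R axis i 1) \<noteq> 0" using \<kappa>(3) by force
    from DERIV_divide[OF w_partial[of x, unfolded has_partial_def] \<kappa>_partial[of x, unfolded has_partial_def] this]
    show ?thesis by (simp add: has_partial_def \<Theta>_def H_def)
  next
    case False
    then have "H x = 0" by (simp add: H_def h_supp w_supp)
    then show ?thesis
      using has_partial_zero_open[OF op(2), of x \<Theta>] False w_supp by (auto simp: \<Theta>_def)
  qed
  have H_cont: "continuous_on UNIV H"
  proof (subst split_UNIV, rule continuous_on_open_Un[OF op])
    show "continuous_on {x. 0 < \<kappa> x} H"
      unfolding H_def
      by (intro continuous_intros continuous_on_subset[OF h_cont] continuous_on_subset[OF w_cont]
          continuous_on_subset[OF \<kappa>_cont] continuous_on_subset[OF \<kappa>'_cont]) auto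
    show "continuous_on (- K) H"
      by (rule continuous_on_eq[of _ "\<lambda>x. 0"]) (auto simp: H_def h_supp w_supp)
  qed

  obtain r where r: "\<And>x. x \<in> L \<Longrightarrow> norm x \<le> r" "0 < r"
    using compact_imp_bounded[OF L(1)] unfolding bounded_pos by blast
  define R where "R = r + 1"
  define Q :: "(real^'n) set" where "Q = {x. \<forall>j. - R \<le> x $ j \<and> x $ j \<le> R}"
  have "Q = cbox (\<chi> j. - R) (\<chi> j. R)" by (auto simp: Q_def mem_box_cart)
  then have Q: "compact Q" by (simp add: compact_cbox)
  obtain M where M: "\<And>x. x \<in> L \<Longrightarrow> \<bar>\<kappa> x\<bar> \<le> M" "\<And>x. x \<in> L \<Longrightarrow> \<bar>?\<kappa>' x\<bar> \<le> M" "0 < M"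
  proof -
    obtain M1 where M1: "\<forall>x\<in>\<kappa> ` L. norm x \<le> M1" "0 < M1"
      using compact_imp_bounded[OF compact_continuous_image[OF continuous_on_subset[OF \<kappa>_cont] L(1)]]
      unfolding bounded_pos by auto
    obtain M2 where M2: "\<forall>x\<in>?\<kappa>' ` L. norm x \<le> M2" "0 < M2"
      using compact_imp_bounded[OF compact_continuous_image[OF continuous_on_subset[OF \<kappa>'_cont] L(1)]]
      unfolding bounded_pos by auto
    from M1 M2 show thesis by (intro that[of "max M1 M2"]) (auto simp: le_max_iff_disj)
  qed

  show thesis
  proof (rule that[OF L(1,2) KL])
    fix \<epsilon> :: real assume \<epsilon>: "0 < \<epsilon>"
    \<comment> \<open>the two error terms \<open>\<kappa> (H - p)\<close> and \<open>\<kappa>' (\<Theta> - q)\<close> then add up to at most \<open>\<epsilon>\<close>\<close>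
    define \<delta> where "\<delta> = \<epsilon> / (M * (1 + 2 * R))"
    have pos: "0 < M * (1 + 2 * R)" "0 < R" using M(3) r(2) by (auto simp: R_def)
    have \<delta>: "0 < \<delta>" using \<epsilon> pos by (simp add: \<delta>_def)
    have M\<delta>: "M * \<delta> + M * (2 * R * \<delta>) = \<epsilon>"
    proof -
      have "M * \<delta> + M * (2 * R * \<delta>) = (M * (1 + 2 * R)) * \<delta>" by (simp add: algebra_simps)
      also have "\<dots> = \<epsilon>"
        unfolding \<delta>_def using pos(1) by (intro nonzero_eq_divide_eq[THEN iffD1, OF _ refl, THEN trans[OF mult.commute]]) auto
      finally show ?thesis .
    qed
    obtain p where p: "real_polynomial_function p" "\<And>x. x \<in> Q \<Longrightarrow> \<bar>H x - p x\<bar> < \<delta>"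
      using Stone_Weierstrass_real_polynomial_function[OF Q continuous_on_subset[OF H_cont] \<delta>] by blast
    obtain q where q: "real_polynomial_function q" "\<And>x. has_partial i q (p x) x"
      "\<And>x. x $ i = - R \<Longrightarrow> q x = 0"
      using real_polynomial_function_primitive[OF p(1)] by blast
    have close: "\<bar>\<Theta> x - q x\<bar> \<le> 2 * R * \<delta>" if x: "x \<in> L" for x
    proof -
      have xr: "\<bar>x $ j\<bar> \<le> r" for j using component_le_norm_cart[of x j] r(1)[OF x] by linarith
      \<comment> \<open>the mean value theorem on the segment from the face \<open>x\<^sub>i = - R\<close> to \<open>x\<close>\<close>
      let ?y = "x - (x $ i + R) *\<^sub>R axis i 1"
      let ?u = "\<lambda>t. \<Theta> (?y + t *\<^sub>R axis i 1) - q (?y + t *\<^sub>R axis i 1)"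
      have "?y \<notin> L"
      proof
        assume "?y \<in> L"
        then have "\<bar>?y $ i\<bar> \<le> r" using component_le_norm_cart[of ?y i] r(1) by (meson order.trans)
        then show False using r(2) by (simp add: R_def)
      qed
      then have u0: "?u 0 = 0" using L(3) q(3)[of ?y] by (simp add: \<Theta>_def)
      have "0 < x $ i + R" using xr[of i] by (auto simp: R_def)
      have der: "(?u has_real_derivative (H (?y + t *\<^sub>R axis i 1) - p (?y + t *\<^sub>R axis i 1))) (at t)" for t
        by (intro DERIV_diff has_partial_along_line \<Theta>_partial q(2))
      obtain t where t: "0 < t" "t < x $ i + R"
        "?u (x $ i + R) - ?u 0 = (x $ i + R - 0) * (H (?y + t *\<^sub>R axis i 1) - p (?y + t *\<^sub>R axis i 1))"
        using MVT2[OF \<open>0 < x $ i + R\<close> der] by blast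
      have "?y + t *\<^sub>R axis i 1 \<in> Q"
        unfolding Q_def
      proof (intro CollectI allI)
        fix j
        show "- R \<le> (?y + t *\<^sub>R axis i 1) $ j \<and> (?y + t *\<^sub>R axis i 1) $ j \<le> R"
          using t(1,2) xr[of j] by (cases "j = i") (auto simp: axis_def R_def)
      qed
      then have "\<bar>?u (x $ i + R)\<bar> \<le> (x $ i + R) * \<delta>"
        using t(3) p(2)[of "?y + t *\<^sub>R axis i 1"] \<open>0 < x $ i + R\<close> u0
        by (simp add: abs_mult mult_left_mono)
      also have "\<dots> \<le> 2 * R * \<delta>" using xr[of i] \<delta> by (intro mult_right_mono) (auto simp: R_def)
      finally show ?thesis by simp
    qed
    have LQ: "x \<in> Q" if "x \<in> L" for x
      unfolding Q_def
    proof (intro CollectI allI)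
      fix j
      show "- R \<le> x $ j \<and> x $ j \<le> R"
        using component_le_norm_cart[of x j] r(1)[OF that] by (simp add: R_def abs_le_iff)
    qed
    define \<phi> where "\<phi> x = \<kappa> x * q x" for x
    have \<phi>_smooth: "C_k k \<phi>" for k
      unfolding \<phi>_def by (intro C_k_mult \<kappa>_smooth C_k_real_polynomial_function q(1))
    have q_diff: "q differentiable (at x)" for x
      by (rule C_k_differentiable[OF C_k_real_polynomial_function[OF q(1)]])
    have \<phi>': "partial_deriv i \<phi> x = \<kappa> x * p x + ?\<kappa>' x * q x" for x
      unfolding \<phi>_def partial_deriv_mult[OF \<kappa>_diff q_diff] partial_deriv_unique[OF q_diff q(2)] ..
    have \<phi>_supp: "\<phi> x = 0 \<and> partial_deriv i \<phi> x = 0" if "x \<notin> L" for x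
      using that L(3) \<kappa>'_supp unfolding \<phi>' by (simp add: \<phi>_def)
    show "\<exists>\<phi>. test_function_on \<Omega> \<phi> \<and> (\<forall>x. x \<notin> L \<longrightarrow> \<phi> x = 0 \<and> partial_deriv i \<phi> x = 0) \<and>
        (\<forall>x. \<bar>w x - \<phi> x\<bar> \<le> \<epsilon> \<and> \<bar>h x - partial_deriv i \<phi> x\<bar> \<le> \<epsilon>)"
    proof (intro exI[of _ \<phi>] conjI allI impI)
      show "test_function_on \<Omega> \<phi>"
        unfolding test_function_on_def using \<phi>_smooth L \<phi>_supp by blast
      fix x
      show "\<phi> x = 0" "partial_deriv i \<phi> x = 0" if "x \<notin> L" using that \<phi>_supp by auto
      have "\<bar>w x - \<phi> x\<bar> \<le> \<epsilon> \<and> \<bar>h x - partial_deriv i \<phi> x\<bar> \<le> \<epsilon>"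
      proof (cases "x \<in> L")
        case True
        have "w x = \<kappa> x * \<Theta> x" using \<kappa>(3)[of x] w_supp[of x] by (cases "x \<in> K") (auto simp: \<Theta>_def)
        then have "\<bar>w x - \<phi> x\<bar> = \<bar>\<kappa> x\<bar> * \<bar>\<Theta> x - q x\<bar>"
          by (simp add: \<phi>_def abs_mult[symmetric] algebra_simps)
        also have "\<dots> \<le> M * (2 * R * \<delta>)"
          by (intro mult_mono M close True) (use M(3) in auto)
        also have "\<dots> \<le> \<epsilon>" using M\<delta> mult_pos_pos[OF M(3) \<delta>] by linarith
        finally have 1: "\<bar>w x - \<phi> x\<bar> \<le> \<epsilon>" .
        have "h x = \<kappa> x * H x + ?\<kappa>' x * \<Theta> x"
          using \<kappa>(3)[of x] w_supp[of x] h_supp[of x]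
          by (cases "x \<in> K") (auto simp: \<Theta>_def H_def field_simps)
        then have "\<bar>h x - partial_deriv i \<phi> x\<bar> = \<bar>\<kappa> x * (H x - p x) + ?\<kappa>' x * (\<Theta> x - q x)\<bar>"
          unfolding \<phi>' by (simp add: algebra_simps)
        also have "\<dots> \<le> \<bar>\<kappa> x\<bar> * \<bar>H x - p x\<bar> + \<bar>?\<kappa>' x\<bar> * \<bar>\<Theta> x - q x\<bar>"
          by (metis abs_mult abs_triangle_ineq)
        also have "\<dots> \<le> M * \<delta> + M * (2 * R * \<delta>)"
          by (intro add_mono mult_mono M close True less_imp_le[OF p(2)] LQ) (use M(3) in auto)
        finally show ?thesis using 1 M\<delta> by simp
      next
        case False
        then have "x \<notin> K" using KL by blast
        then show ?thesis using \<phi>_supp[OF False] w_supp h_supp \<epsilon> by simp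
      qed
      then show "\<bar>w x - \<phi> x\<bar> \<le> \<epsilon>" "\<bar>h x - partial_deriv i \<phi> x\<bar> \<le> \<epsilon>" by auto
    qed
  qed
qed

lemma set_integrable_mult_continuous:
  fixes f g :: "real^'n \<Rightarrow> real"
  assumes "set_integrable lborel K f" "compact K" "continuous_on K g"
  shows "set_integrable lborel K (\<lambda>x. f x * g x)"
proof -
  obtain M where M: "\<And>x. x \<in> K \<Longrightarrow> \<bar>g x\<bar> \<le> M"
    using compact_imp_bounded[OF compact_continuous_image[OF assms(3,2)]] unfolding bounded_iff by auto
  have "(\<lambda>x. indicator K x *\<^sub>R g x) \<in> borel_measurable borel"
    by (rule borel_measurable_continuous_on_indicator[OF _ assms(3)]) (use assms(2) in \<open>simp add: borel_compact\<close>)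
  moreover have "(\<lambda>x. indicator K x *\<^sub>R f x) \<in> borel_measurable borel"
    using assms(1) unfolding set_integrable_def by auto
  ultimately have "(\<lambda>x. (indicator K x *\<^sub>R f x) * (indicator K x *\<^sub>R g x)) \<in> borel_measurable lborel"
    by simp
  moreover have "(\<lambda>x. (indicator K x *\<^sub>R f x) * (indicator K x *\<^sub>R g x)) = (\<lambda>x. indicator K x *\<^sub>R (f x * g x))"
    by (auto simp: indicator_def)
  ultimately have meas: "(\<lambda>x. indicator K x *\<^sub>R (f x * g x)) \<in> borel_measurable lborel" by simp
  show ?thesis
    unfolding set_integrable_def
  proof (rule Bochner_Integration.integrable_bound[OF _ meas])
    show "integrable lborel (\<lambda>x. M * (indicator K x *\<^sub>R f x))"
      using assms(1) unfolding set_integrable_def by simp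
    show "AE x in lborel. norm (indicator K x *\<^sub>R (f x * g x)) \<le> norm (M * (indicator K x *\<^sub>R f x))"

    proof (rule AE_I2)
      fix x
      have "\<bar>f x\<bar> * \<bar>g x\<bar> \<le> \<bar>M\<bar> * \<bar>f x\<bar>" if "x \<in> K"
        using mult_left_mono[OF order.trans[OF M[OF that] abs_ge_self], of "\<bar>f x\<bar>"] by (simp add: mult.commute)
      then show "norm (indicator K x *\<^sub>R (f x * g x)) \<le> norm (M * (indicator K x *\<^sub>R f x))"
        by (simp add: indicator_def abs_mult)
    qed
  qed
qed

text \<open>The defining identity extends from smooth test functions by \<open>test_function_approximation\<close>: both
  sides are continuous in \<open>(w, h)\<close> with respect to uniform convergence with supports in a fixed
  compact set, because \<open>f\<close> and \<open>g\<close> are locally integrable.\<close>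

lemma weak_gradient_nonsmooth_test:
  fixes \<Omega> :: "(real^'n) set"
  assumes "open \<Omega>" and fg: "has_weak_gradient \<Omega> f g" and "compact K" "K \<subseteq> \<Omega>"
    and w_cont: "continuous_on UNIV w" and w_supp: "\<And>x. x \<notin> K \<Longrightarrow> w x = 0"
    and w_partial: "\<And>x. has_partial i w (h x) x" and h_cont: "continuous_on UNIV h"
  shows "(LINT x:\<Omega>|lborel. f x * h x) = - (LINT x:\<Omega>|lborel. g x $ i * w x)"
proof -
  obtain L where L: "compact L" "L \<subseteq> \<Omega>" "K \<subseteq> L" and approx:
    "\<And>\<epsilon>. 0 < \<epsilon> \<Longrightarrow> \<exists>\<phi>. test_function_on \<Omega> \<phi> \<and> (\<forall>x. x \<notin> L \<longrightarrow> \<phi> x = 0 \<and> partial_deriv i \<phi> x = 0) \<and>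
        (\<forall>x. \<bar>w x - \<phi> x\<bar> \<le> \<epsilon> \<and> \<bar>h x - partial_deriv i \<phi> x\<bar> \<le> \<epsilon>)"
    using test_function_approximation[OF assms(1,3,4) w_cont w_supp w_partial h_cont] by blast
  have h_supp: "h x = 0" if "x \<notin> K" for x
    by (rule has_partial_unique[OF w_partial has_partial_zero_open[of "- K"]])
      (use that assms compact_imp_closed[OF assms(3)] in auto)
  have restrict: "(LINT x:\<Omega>|lborel. k x * u x) = (LINT x:L|lborel. k x * u x)"
    if "\<And>x. x \<notin> L \<Longrightarrow> u x = 0" for k u :: "real^'n \<Rightarrow> real"
    unfolding set_lebesgue_integral_def
    by (rule Bochner_Integration.integral_cong) (use that L(2) in \<open>auto simp: indicator_def\<close>)
  have f_int: "set_integrable lborel L f" and g_int: "set_integrable lborel L (\<lambda>x. g x $ i)"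
    using fg L(1,2) unfolding has_weak_gradient_def locally_integrable_on_def by auto
  define A where "A = (LINT x:L|lborel. \<bar>f x\<bar>) + (LINT x:L|lborel. \<bar>g x $ i\<bar>)"
  have est: "\<bar>LINT x:L|lborel. k x * u x\<bar> \<le> \<epsilon> * (LINT x:L|lborel. \<bar>k x\<bar>)"
    if k: "set_integrable lborel L k" and u: "continuous_on L u" "\<And>x. \<bar>u x\<bar> \<le> \<epsilon>"
    for k u :: "real^'n \<Rightarrow> real" and \<epsilon>
  proof -
    have "norm (LINT x:L|lborel. k x * u x) \<le> (LINT x:L|lborel. norm (k x * u x))"
      by (rule set_integral_norm_bound[OF set_integrable_mult_continuous[OF k L(1) u(1)]])
    also have "\<dots> \<le> (LINT x:L|lborel. \<epsilon> * \<bar>k x\<bar>)"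
    proof (rule set_integral_mono)
      show "set_integrable lborel L (\<lambda>x. norm (k x * u x))"
        by (rule set_integrable_norm[OF set_integrable_mult_continuous[OF k L(1) u(1)]])
      show "set_integrable lborel L (\<lambda>x. \<epsilon> * \<bar>k x\<bar>)"
        using set_integrable_norm[OF k] by (intro set_integrable_mult_right) simp
      show "norm (k x * u x) \<le> \<epsilon> * \<bar>k x\<bar>" for x
        using mult_right_mono[OF u(2)[of x], of "\<bar>k x\<bar>"] by (simp add: abs_mult mult.commute)
    qed
    finally show ?thesis by simp
  qed
  let ?I = "(LINT x:L|lborel. f x * h x) + (LINT x:L|lborel. g x $ i * w x)"
  have bound: "\<bar>?I\<bar> \<le> \<epsilon> * A" if \<epsilon>: "0 < \<epsilon>" for \<epsilon>
  proof -
    obtain \<phi> where \<phi>: "test_function_on \<Omega> \<phi>" "\<And>x. x \<notin> L \<Longrightarrow> \<phi> x = 0"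
      "\<And>x. x \<notin> L \<Longrightarrow> partial_deriv i \<phi> x = 0"
      "\<And>x. \<bar>w x - \<phi> x\<bar> \<le> \<epsilon>" "\<And>x. \<bar>h x - partial_deriv i \<phi> x\<bar> \<le> \<epsilon>"
      using approx[OF \<epsilon>] by blast
    have smooth: "\<And>k. C_k k \<phi>" using \<phi>(1) by (simp add: test_function_on_def)
    have \<phi>_cont: "continuous_on L \<phi>" "continuous_on L (partial_deriv i \<phi>)"
      using smooth[of 0] continuous_partial_deriv_C_k[OF smooth, of i] by (auto intro: continuous_on_subset)
    have wh_cont: "continuous_on L w" "continuous_on L h"
      using w_cont h_cont by (auto intro: continuous_on_subset)
    have "(LINT x:L|lborel. f x * partial_deriv i \<phi> x) + (LINT x:L|lborel. g x $ i * \<phi> x) = 0"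
      using fg \<phi>(1) restrict[of "partial_deriv i \<phi>" f, OF \<phi>(3)] restrict[of \<phi> "\<lambda>x. g x $ i", OF \<phi>(2)]
      by (simp add: has_weak_gradient_def)
    then have "?I = (LINT x:L|lborel. f x * h x - f x * partial_deriv i \<phi> x)
        + (LINT x:L|lborel. g x $ i * w x - g x $ i * \<phi> x)"
      using L(1) f_int g_int \<phi>_cont wh_cont
      by (simp add: set_integral_diff set_integrable_mult_continuous)
    also have "\<dots> = (LINT x:L|lborel. f x * (h x - partial_deriv i \<phi> x))
        + (LINT x:L|lborel. g x $ i * (w x - \<phi> x))"
      by (simp add: algebra_simps)
    also have "\<bar>\<dots>\<bar> \<le> \<epsilon> * (LINT x:L|lborel. \<bar>f x\<bar>) + \<epsilon> * (LINT x:L|lborel. \<bar>g x $ i\<bar>)"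
      by (intro order.trans[OF abs_triangle_ineq] add_mono est f_int g_int \<phi> continuous_on_diff
          \<phi>_cont wh_cont)
    finally show ?thesis by (simp add: A_def algebra_simps)
  qed
  have "\<bar>?I\<bar> \<le> 0"
  proof (rule field_le_epsilon)
    fix e :: real assume e: "0 < e"
    have A: "0 \<le> A" unfolding A_def set_lebesgue_integral_def
      by (intro add_nonneg_nonneg Bochner_Integration.integral_nonneg) auto
    with e have "\<bar>?I\<bar> \<le> e / (A + 1) * A" by (intro bound) simp
    also have "\<dots> \<le> 0 + e" using A e by (simp add: field_simps)
    finally show "\<bar>?I\<bar> \<le> 0 + e" .
  qed
  show ?thesis
  proof -
    have "h x = 0" "w x = 0" if "x \<notin> L" for x using that h_supp w_supp L(3) by auto
    from restrict[of h f, OF this(1)] restrict[of w "\<lambda>x. g x $ i", OF this(2)]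
    show ?thesis using \<open>\<bar>?I\<bar> \<le> 0\<close> by linarith
  qed
qed

section \<open>Change of variables for coordinatewise maps\<close>

lemma measurable_on_open_extension:
  assumes "open P" "continuous_on P u"
  shows "(\<lambda>t. if t \<in> P then u t else c) \<in> borel_measurable borel"
  by (rule borel_measurable_continuous_on_if[OF borel_open[OF assms(1)] assms(2) continuous_on_const])

lemma emeasure_distr_density:
  assumes f: "f \<in> borel_measurable M" and T: "T \<in> M \<rightarrow>\<^sub>M N" and A: "A \<in> sets N"
  shows "emeasure (distr (density M f) N T) A = (\<integral>\<^sup>+ x. f x * indicator A (T x) \<partial>M)"
proof -
  have "emeasure (distr (density M f) N T) A = emeasure (density M f) (T -` A \<inter> space M)"
    using T A by (subst emeasure_distr) simp_all
  also have "\<dots> = (\<integral>\<^sup>+ x. f x * indicator (T -` A \<inter> space M) x \<partial>M)"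
    by (rule emeasure_density[OF f measurable_sets[OF T A]])
  also have "\<dots> = (\<integral>\<^sup>+ x. f x * indicator A (T x) \<partial>M)"
    by (rule nn_integral_cong) (simp add: indicator_def)
  finally show ?thesis .
qed

text \<open>For bounded \<open>A\<close> this is the change of variables formula for the indicator function of \<open>A\<close>, where
  all integrals are finite; arbitrary \<open>A\<close> are exhausted by bounded sets.\<close>

lemma distr_density_deriv_1D:
  fixes u u' :: "real \<Rightarrow> real"
  assumes P: "open P" and P': "open P'" and der: "\<And>t. t \<in> P \<Longrightarrow> (u has_real_derivative u' t) (at t)"
    and pos: "\<And>t. t \<in> P \<Longrightarrow> 0 \<le> u' t" and cont: "continuous_on P u'"
    and inj: "inj_on u P" and img: "u ` P = P'"
  shows "distr (density lborel (\<lambda>t. ennreal (if t \<in> P then u' t else 0))) borel (\<lambda>t. if t \<in> P then u t else 0)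
    = density lborel (\<lambda>t. ennreal (indicator P' t))" (is "?M = ?N")
proof (rule measure_eqI)
  show "sets ?M = sets ?N" by simp
  have u_cont: "continuous_on P u"
    by (meson DERIV_continuous continuous_at_imp_continuous_on der)
  note meas_u[measurable] = measurable_on_open_extension[OF P u_cont, of 0]
  note meas_u'[measurable] = measurable_on_open_extension[OF P cont, of 0]
  have meas_P'[measurable]: "P' \<in> sets borel" using P' by simp
  have bounded_case: "emeasure ?M A = emeasure ?N A" if A[measurable]: "A \<in> sets borel" and bd: "bounded A" for A
  proof -
    let ?g = "\<lambda>t. (if t \<in> P then u' t else 0) * indicator A (if t \<in> P then u t else 0) :: real"
    have fin: "emeasure lborel (A \<inter> P') < \<infinity>"
      by (rule emeasure_bounded_finite) (use bd in \<open>auto intro: bounded_subset\<close>)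
    have "integrable lborel (\<lambda>x. indicator (A \<inter> P') x :: real)"
      using fin by simp
    moreover have "(\<lambda>x. indicator (A \<inter> P') x) = (\<lambda>x. indicator P' x *\<^sub>R indicator A x :: real)"
      by (auto simp: indicator_def)
    ultimately have abs: "(indicator A :: real \<Rightarrow> real) absolutely_integrable_on P'"
      by (simp add: set_integrable_def integrable_completion)
    then obtain b where b: "((indicator A :: real \<Rightarrow> real) has_integral b) P'"
      using set_lebesgue_integral_eq_integral(1) by blast
    from has_absolute_integral_change_of_variables_1'[of P u u' "indicator A" b] abs b
    have "(\<lambda>x. \<bar>u' x\<bar> * indicator A (u x)) absolutely_integrable_on P"
      "integral P (\<lambda>x. \<bar>u' x\<bar> * indicator A (u x)) = b"
      using P inj img der[THEN DERIV_subset] by (auto simp: integral_unique lmeasurable_open)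
    then have "((\<lambda>x. \<bar>u' x\<bar> * indicator A (u x)) has_integral b) P"
      using set_lebesgue_integral_eq_integral(1) integrable_integral by blast
    then have "(?g has_integral b) P"
      by (rule has_integral_eq[rotated]) (use pos in auto)
    then have 1: "(\<integral>\<^sup>+ x. ennreal (indicator P x * ?g x) \<partial>lborel) = ennreal b"
      using pos by (intro nn_integral_has_integral_lebesgue) auto
    have "emeasure ?M A = (\<integral>\<^sup>+ x. ennreal (if x \<in> P then u' x else 0) *
        indicator A (if x \<in> P then u x else 0) \<partial>lborel)"
      by (rule emeasure_distr_density) measurable
    also have "\<dots> = (\<integral>\<^sup>+ x. ennreal (indicator P x * ?g x) \<partial>lborel)"
      by (rule nn_integral_cong) (auto simp: indicator_def)
    also note 1
    also have "ennreal b = (\<integral>\<^sup>+ x. ennreal (indicator P' x * indicator A x) \<partial>lborel)"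
      using b by (intro nn_integral_has_integral_lebesgue[symmetric]) auto
    also have "\<dots> = emeasure ?N A"
      by (subst emeasure_density) (auto intro!: nn_integral_cong simp: indicator_def)
    finally show ?thesis .
  qed
  fix A assume "A \<in> sets ?M"
  then have A[measurable]: "A \<in> sets borel" by simp
  have U: "(\<Union>k. A \<inter> {- real k..real k}) = A"
    by (auto simp: abs_le_iff[symmetric]) (meson abs_le_iff minus_le_iff real_arch_simple)
  have inc: "incseq (\<lambda>k. A \<inter> {- real k..real k})" by (auto simp: incseq_def)
  have "emeasure ?M A = (SUP k. emeasure ?M (A \<inter> {- real k..real k}))"
    using SUP_emeasure_incseq[OF _ inc, of ?M] U by (simp add: image_subset_iff)
  also have "\<dots> = (SUP k. emeasure ?N (A \<inter> {- real k..real k}))"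
    by (intro SUP_cong refl bounded_case) (auto intro: bounded_subset)
  also have "\<dots> = emeasure ?N A"
    using SUP_emeasure_incseq[OF _ inc, of ?N] U by (simp add: image_subset_iff)
  finally show "emeasure ?M A = emeasure ?N A" .
qed

lemma borel_measurable_vec_lambda:
  fixes f :: "'n::finite \<Rightarrow> 'a \<Rightarrow> real"
  assumes "\<And>i. f i \<in> borel_measurable M"
  shows "(\<lambda>x. \<chi> i. f i x) \<in> borel_measurable M"
  by (subst borel_measurable_euclidean_space) (auto simp: Basis_vec_def inner_axis assms)

lemma measurable_vec_lambda_PiM:
  fixes N :: "'n::finite \<Rightarrow> real measure"
  assumes "\<And>i. sets (N i) = sets borel"
  shows "vec_lambda \<in> borel_measurable (PiM UNIV N)"
proof -
  have "(\<lambda>x. x i) \<in> PiM UNIV N \<rightarrow>\<^sub>M borel" for i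
    by (subst measurable_cong_sets[OF refl assms[of i, symmetric]]) (rule measurable_component_singleton, simp)
  then have "(\<lambda>x. \<chi> i. x i) \<in> borel_measurable (PiM UNIV N)" by (rule borel_measurable_vec_lambda)
  then show ?thesis by simp
qed

lemma borel_measurable_vec_nth [measurable]: "(\<lambda>x :: real^'n. x $ i) \<in> borel_measurable borel"
  by (intro borel_measurable_continuous_onI continuous_intros)

lemma lborel_eq_distr_PiM:
  "(lborel :: (real^'n) measure) = distr (PiM UNIV (\<lambda>_. lborel)) borel vec_lambda"
proof (rule lborel_eqI)
  interpret product_sigma_finite "\<lambda>_ :: 'n. lborel :: real measure" by standard
  have [measurable]: "vec_lambda \<in> borel_measurable (PiM UNIV (\<lambda>_ :: 'n. lborel :: real measure))"
    by (rule measurable_vec_lambda_PiM) simp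
  fix l u :: "real^'n" assume le: "\<And>b. b \<in> Basis \<Longrightarrow> l \<bullet> b \<le> u \<bullet> b"
  have le': "l $ i \<le> u $ i" for i
  proof -
    have "axis i (1::real) \<in> Basis" by (auto simp: Basis_vec_def)
    from le[OF this] show ?thesis by (simp add: inner_axis)
  qed
  have "vec_lambda -` box l u \<inter> space (PiM UNIV (\<lambda>_. lborel)) = PiE UNIV (\<lambda>i. {l $ i <..< u $ i})"
    by (auto simp: mem_box_cart space_PiM PiE_iff)
  then have "emeasure (distr (PiM UNIV (\<lambda>_. lborel)) borel vec_lambda) (box l u)
      = (\<Prod>i\<in>UNIV. emeasure lborel {l $ i <..< u $ i})"
    by (subst emeasure_distr) (simp_all add: emeasure_PiM)
  also have "\<dots> = (\<Prod>i\<in>UNIV. ennreal (u $ i - l $ i))"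
    by (intro prod.cong refl emeasure_lborel_Ioo le')
  also have "\<dots> = ennreal (\<Prod>i\<in>UNIV. u $ i - l $ i)"
    using le' by (intro prod_ennreal) simp
  also have "(\<Prod>i\<in>UNIV. u $ i - l $ i) = (\<Prod>b\<in>Basis. (u - l) \<bullet> b)"
    by (subst prod.reindex_bij_betw[symmetric, where h = "\<lambda>i. axis i 1" and S = UNIV])
      (auto simp: bij_betw_def Basis_vec_def inj_on_def axis_eq_axis inner_axis)
  finally show "emeasure (distr (PiM UNIV (\<lambda>_. lborel)) borel vec_lambda) (box l u) = (\<Prod>b\<in>Basis. (u - l) \<bullet> b)" .
qed simp

lemma nn_integral_lborel_prod_cart:
  fixes f :: "'n::finite \<Rightarrow> real \<Rightarrow> ennreal"
  assumes [measurable]: "\<And>i. f i \<in> borel_measurable borel"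
  shows "(\<integral>\<^sup>+ x. (\<Prod>i\<in>UNIV. f i (x $ i)) \<partial>lborel) = (\<Prod>i\<in>UNIV. \<integral>\<^sup>+ t. f i t \<partial>lborel)"
proof -
  interpret product_sigma_finite "\<lambda>_ :: 'n. lborel :: real measure" by standard
  have [measurable]: "vec_lambda \<in> borel_measurable (PiM UNIV (\<lambda>_ :: 'n. lborel :: real measure))"
    by (rule measurable_vec_lambda_PiM) simp
  show ?thesis
    by (subst lborel_eq_distr_PiM) (simp add: nn_integral_distr product_nn_integral_prod)
qed

lemma prod_indicator_UNIV:
  fixes f :: "'n::finite \<Rightarrow> 'a"
  shows "(\<Prod>i\<in>UNIV. indicator (A i) (f i)) = (of_bool (\<forall>i. f i \<in> A i) :: ennreal)"
  by (auto simp: indicator_def intro!: prod_zero)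

text \<open>Taking components identifies \<open>real^'n\<close> with the functions on \<open>'n\<close>; along this identification the
  uniqueness of product measures carries over.\<close>

lemma measure_eqI_rectangles:
  fixes M :: "(real^'n) measure" and N :: "'n \<Rightarrow> real measure"
  assumes N: "\<And>i. sigma_finite_measure (N i)" "\<And>i. sets (N i) = sets borel"
    and M: "sets M = sets borel" "\<And>A. (\<And>i. A i \<in> sets borel) \<Longrightarrow>
      emeasure M {x. \<forall>i. x $ i \<in> A i} = (\<Prod>i\<in>UNIV. emeasure (N i) (A i))"
  shows "M = distr (PiM UNIV N) borel vec_lambda"
proof -
  interpret product_sigma_finite N by (rule product_sigma_finite.intro) (rule N)
  have sets_PiM_N: "sets (PiM UNIV N) = sets (PiM UNIV (\<lambda>_ :: 'n. borel :: real measure))"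
    using N(2) by (intro sets_PiM_cong refl)
  have m1: "vec_nth \<in> M \<rightarrow>\<^sub>M PiM UNIV N"
    unfolding measurable_cong_sets[OF M(1) sets_PiM_N]
    by (rule measurable_PiM_single') (auto simp: space_PiM)
  have m2: "vec_lambda \<in> borel_measurable (PiM UNIV N)"
    by (rule measurable_vec_lambda_PiM) (rule N(2))
  have "distr M (PiM UNIV N) vec_nth = PiM UNIV N"
  proof (rule PiM_eqI)
    fix A assume A: "\<And>i. i \<in> (UNIV :: 'n set) \<Longrightarrow> A i \<in> sets (N i)"
    have "vec_nth -` PiE UNIV A \<inter> space M = {x. \<forall>i. x $ i \<in> A i}"
      using sets_eq_imp_space_eq[OF M(1)] by (auto simp: PiE_def)
    then show "emeasure (distr M (PiM UNIV N) vec_nth) (PiE UNIV A) = (\<Prod>i\<in>UNIV. emeasure (N i) (A i))"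
      using A M(2)[of A] N(2) by (subst emeasure_distr[OF m1]) (auto intro!: sets_PiM_I_finite)
  qed auto
  then have "distr (PiM UNIV N) borel vec_lambda = distr (distr M (PiM UNIV N) vec_nth) borel vec_lambda"
    by simp
  also have "\<dots> = distr M borel (vec_lambda \<circ> vec_nth)" by (rule distr_distr[OF m2 m1])
  also have "vec_lambda \<circ> vec_nth = (\<lambda>x :: real^'n. x)" by auto
  also have "distr M borel (\<lambda>x. x) = M" by (rule distr_id2[OF M(1)[symmetric]])
  finally show ?thesis ..
qed

locale coordinatewise_C1 =
  fixes P P' :: "'n::finite \<Rightarrow> real set" and u u' :: "'n \<Rightarrow> real \<Rightarrow> real"
  assumes P: "\<And>i. open (P i)" and P': "\<And>i. open (P' i)"
    and der: "\<And>i t. t \<in> P i \<Longrightarrow> (u i has_real_derivative u' i t) (at t)"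
    and pos: "\<And>i t. t \<in> P i \<Longrightarrow> 0 \<le> u' i t" and cont: "\<And>i. continuous_on (P i) (u' i)"
    and inj: "\<And>i. inj_on (u i) (P i)" and img: "\<And>i. u i ` P i = P' i"
begin

lemma u_cont: "continuous_on (P i) (u i)"
  by (meson DERIV_continuous continuous_at_imp_continuous_on der)

text \<open>The Jacobian of a coordinatewise map is a product of one-dimensional derivatives, so the
  statement reduces to the one-dimensional one by uniqueness of product measures.\<close>

lemma distr_density_deriv_product:
  shows "distr (density lborel (\<lambda>x. \<Prod>i\<in>UNIV. ennreal (if x $ i \<in> P i then u' i (x $ i) else 0))) borel
      (\<lambda>x. \<chi> i. if x $ i \<in> P i then u i (x $ i) else 0)
    = density lborel (\<lambda>x :: real^'n. \<Prod>i\<in>UNIV. ennreal (indicator (P' i) (x $ i)))" (is "?M = ?N")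
proof -
  note meas_u[measurable] = measurable_on_open_extension[OF P u_cont, of _ 0]
  note meas_u'[measurable] = measurable_on_open_extension[OF P cont, of _ 0]
  have meas_P'[measurable]: "P' i \<in> sets borel" for i using P' by simp
  have meas_U[measurable]:
    "(\<lambda>x :: real^'n. \<chi> i. if x $ i \<in> P i then u i (x $ i) else 0) \<in> borel_measurable borel"
    by (rule borel_measurable_vec_lambda, rule measurable_compose[OF borel_measurable_vec_nth meas_u])
  define D where "D i = density lborel (\<lambda>t. ennreal (indicator (P' i) t))" for i
  have sf: "sigma_finite_measure (D i)" for i
    unfolding D_def by (subst sigma_finite_measure.sigma_finite_iff_density_finite[OF sigma_finite_lborel]) auto
  have dens1: "(\<lambda>x :: real^'n. ennreal (if x $ i \<in> P i then u' i (x $ i) else 0)) \<in> borel_measurable borel" for i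
    by (intro measurable_compose[OF borel_measurable_vec_nth measurable_compose[OF meas_u' measurable_ennreal]])
  have "?M = distr (PiM UNIV D) borel vec_lambda"
  proof (rule measure_eqI_rectangles[OF sf])
    fix A :: "'n \<Rightarrow> real set" assume A[measurable]: "\<And>i. A i \<in> sets borel"
    have [measurable]: "{x :: real^'n. \<forall>i. x $ i \<in> A i} \<in> sets borel" by measurable
    have "emeasure ?M {x. \<forall>i. x $ i \<in> A i} = (\<integral>\<^sup>+ x. (\<Prod>i\<in>UNIV. ennreal (if x $ i \<in> P i then u' i (x $ i) else 0)) *
        indicator {x. \<forall>i. x $ i \<in> A i} (\<chi> i. if x $ i \<in> P i then u i (x $ i) else 0) \<partial>lborel)"
      using dens1 by (intro emeasure_distr_density) (simp_all add: meas_U)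
    also have "\<dots> = (\<integral>\<^sup>+ x. (\<Prod>i\<in>UNIV. ennreal (if x $ i \<in> P i then u' i (x $ i) else 0) *
        indicator (A i) (if x $ i \<in> P i then u i (x $ i) else 0)) \<partial>lborel)"
      by (simp add: prod.distrib prod_indicator_UNIV) (simp add: indicator_def)
    also have "\<dots> = (\<Prod>i\<in>UNIV. \<integral>\<^sup>+ t. ennreal (if t \<in> P i then u' i t else 0) *
        indicator (A i) (if t \<in> P i then u i t else 0) \<partial>lborel)"
      by (rule nn_integral_lborel_prod_cart) measurable
    also have "\<dots> = (\<Prod>i\<in>UNIV. emeasure (D i) (A i))"
    proof (rule prod.cong[OF refl])
      fix i
      have "(\<integral>\<^sup>+ t. ennreal (if t \<in> P i then u' i t else 0) *
        indicator (A i) (if t \<in> P i then u i t else 0) \<partial>lborel)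
        = emeasure (distr (density lborel (\<lambda>t. ennreal (if t \<in> P i then u' i t else 0))) borel
            (\<lambda>t. if t \<in> P i then u i t else 0)) (A i)"
        by (rule emeasure_distr_density[symmetric]) measurable
      also have "\<dots> = emeasure (D i) (A i)"
        unfolding D_def by (subst distr_density_deriv_1D[OF P P' der pos cont inj img]) auto
      finally show "(\<integral>\<^sup>+ t. ennreal (if t \<in> P i then u' i t else 0) *
        indicator (A i) (if t \<in> P i then u i t else 0) \<partial>lborel) = emeasure (D i) (A i)" .
    qed
    finally show "emeasure ?M {x. \<forall>i. x $ i \<in> A i} = (\<Prod>i\<in>UNIV. emeasure (D i) (A i))" .
  qed (auto simp: D_def)
  moreover have "?N = distr (PiM UNIV D) borel vec_lambda"
  proof (rule measure_eqI_rectangles[OF sf])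
    fix A :: "'n \<Rightarrow> real set" assume A[measurable]: "\<And>i. A i \<in> sets borel"
    have [measurable]: "{x :: real^'n. \<forall>i. x $ i \<in> A i} \<in> sets borel" by measurable
    have "emeasure ?N {x. \<forall>i. x $ i \<in> A i} = (\<integral>\<^sup>+ x. (\<Prod>i\<in>UNIV. ennreal (indicator (P' i) (x $ i)) *
        indicator (A i) (x $ i)) \<partial>lborel)"
      by (simp add: emeasure_density prod.distrib prod_indicator_UNIV) (simp add: indicator_def)
    also have "\<dots> = (\<Prod>i\<in>UNIV. \<integral>\<^sup>+ t. ennreal (indicator (P' i) t) * indicator (A i) t \<partial>lborel)"
      by (rule nn_integral_lborel_prod_cart) measurable
    also have "\<dots> = (\<Prod>i\<in>UNIV. emeasure (D i) (A i))"
      unfolding D_def by (intro prod.cong refl) (simp add: emeasure_density)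
    finally show "emeasure ?N {x. \<forall>i. x $ i \<in> A i} = (\<Prod>i\<in>UNIV. emeasure (D i) (A i))" .
  qed (auto simp: D_def)
  ultimately show ?thesis by simp
qed

text \<open>The previous lemma restricted to \<open>\<Omega>\<close>, which need not be a product: since every coordinate map is
  injective, the points of the product of the \<open>P i\<close> that are mapped into \<open>\<Omega>'\<close> are exactly those of
  \<open>\<Omega>\<close>. The default value \<open>0\<close> outside \<open>\<Omega>\<close> makes the map Borel on the whole space.\<close>

lemma distr_density_jacobian:
  assumes \<Omega>[measurable]: "\<Omega> \<in> sets borel" and \<Omega>'[measurable]: "\<Omega>' \<in> sets borel"
    and \<Omega>P: "\<Omega> \<subseteq> {x. \<forall>i. x $ i \<in> P i}" and U: "(\<lambda>x. \<chi> i. u i (x $ i)) ` \<Omega> = \<Omega>'"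
  shows "distr (density lborel (\<lambda>x. ennreal (indicator \<Omega> x * (\<Prod>i\<in>UNIV. u' i (x $ i))))) borel
      (\<lambda>x. if x \<in> \<Omega> then \<chi> i. u i (x $ i) else 0)
    = density lborel (\<lambda>x. ennreal (indicator \<Omega>' x))" (is "?M = ?N")
    and "(\<lambda>x. indicator \<Omega> x * (\<Prod>i\<in>UNIV. u' i (x $ i))) \<in> borel_measurable borel" (is ?jac)
    and "(\<lambda>x. if x \<in> \<Omega> then \<chi> i. u i (x $ i) else 0) \<in> borel_measurable borel" (is ?map)
proof -
  let ?U = "\<lambda>x :: real^'n. \<chi> i. if x $ i \<in> P i then u i (x $ i) else 0"
  let ?J = "\<lambda>x :: real^'n. \<Prod>i\<in>UNIV. ennreal (if x $ i \<in> P i then u' i (x $ i) else 0)"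
  note meas_u[measurable] = measurable_on_open_extension[OF P u_cont, of _ 0]
  note meas_u'[measurable] = measurable_on_open_extension[OF P cont, of _ 0]
  have meas_U[measurable]: "?U \<in> borel_measurable borel"
    by (rule borel_measurable_vec_lambda, rule measurable_compose[OF borel_measurable_vec_nth meas_u])
  have meas_j: "(\<lambda>x :: real^'n. if x $ i \<in> P i then u' i (x $ i) else 0) \<in> borel_measurable borel" for i
    by (rule measurable_compose[OF borel_measurable_vec_nth meas_u'])
  have meas_J[measurable]: "?J \<in> borel_measurable borel"
    by (intro borel_measurable_prod_ennreal measurable_compose[OF meas_j measurable_ennreal])
  have jac_eq: "indicator \<Omega> x * (\<Prod>i\<in>UNIV. u' i (x $ i))
      = indicator \<Omega> x * (\<Prod>i\<in>UNIV. if x $ i \<in> P i then u' i (x $ i) else 0)" for x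
    using \<Omega>P by (auto simp: indicator_def intro!: prod.cong)
  show jac: ?jac unfolding jac_eq by (intro borel_measurable_times borel_measurable_prod meas_j) measurable
  have map_eq: "(if x \<in> \<Omega> then \<chi> i. u i (x $ i) else 0) = (if x \<in> \<Omega> then ?U x else 0)" for x
    using \<Omega>P by (auto simp: vec_eq_iff)
  show map: ?map unfolding map_eq by measurable
  show "?M = ?N"
  proof (rule measure_eqI)
    fix A assume "A \<in> sets ?M"
    then have A[measurable]: "A \<in> sets borel" by simp
    have pull: "?U x \<in> A \<inter> \<Omega>' \<longleftrightarrow> x \<in> \<Omega> \<and> (\<chi> i. u i (x $ i)) \<in> A" if x: "\<And>i. x $ i \<in> P i" for x
    proof -
      have "?U x = (\<chi> i. u i (x $ i))" using x by simp
      moreover have "x \<in> \<Omega>" if mem: "(\<chi> i. u i (x $ i)) \<in> \<Omega>'"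
      proof -
        obtain y where y: "y \<in> \<Omega>" "(\<chi> i. u i (x $ i)) = (\<chi> i. u i (y $ i))" using mem U by blast
        then have "x $ i = y $ i" for i
          using inj_onD[OF inj, of i "x $ i" "y $ i"] x subsetD[OF \<Omega>P y(1)] y(2) by (simp add: vec_eq_iff)
        then have "x = y" by (simp add: vec_eq_iff)
        with y show ?thesis by simp
      qed
      ultimately show ?thesis using U by auto
    qed
    have "emeasure ?M A = (\<integral>\<^sup>+ x. ennreal (indicator \<Omega> x * (\<Prod>i\<in>UNIV. u' i (x $ i))) *
        indicator A (if x \<in> \<Omega> then \<chi> i. u i (x $ i) else 0) \<partial>lborel)"
      using jac map by (intro emeasure_distr_density) simp_all
    also have "\<dots> = (\<integral>\<^sup>+ x. ?J x * indicator (A \<inter> \<Omega>') (?U x) \<partial>lborel)"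
    proof (rule nn_integral_cong)
      fix x :: "real^'n"
      show "ennreal (indicator \<Omega> x * (\<Prod>i\<in>UNIV. u' i (x $ i))) * indicator A (if x \<in> \<Omega> then \<chi> i. u i (x $ i) else 0)
        = ?J x * indicator (A \<inter> \<Omega>') (?U x)"
      proof (cases "\<forall>i. x $ i \<in> P i")
        case True
        then have "?J x = ennreal (\<Prod>i\<in>UNIV. u' i (x $ i))" using pos by (simp add: prod_ennreal)
        with pull[of x] True show ?thesis by (auto simp: indicator_def)
      next
        case False
        then have "x \<notin> \<Omega>" "?J x = 0" using \<Omega>P by (auto intro!: prod_zero)
        then show ?thesis by simp
      qed
    qed
    also have "\<dots> = emeasure (distr (density lborel ?J) borel ?U) (A \<inter> \<Omega>')"
      by (rule emeasure_distr_density[symmetric]) (simp_all add: meas_U meas_J)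
    also have "\<dots> = emeasure (density lborel (\<lambda>x :: real^'n. \<Prod>i\<in>UNIV. ennreal (indicator (P' i) (x $ i)))) (A \<inter> \<Omega>')"
      by (subst distr_density_deriv_product) auto
    also have "\<dots> = (\<integral>\<^sup>+ x. (\<Prod>i\<in>UNIV. ennreal (indicator (P' i) (x $ i))) * indicator (A \<inter> \<Omega>') x \<partial>lborel)"
    proof (intro emeasure_density borel_measurable_prod_ennreal)
      have [measurable]: "P' i \<in> sets borel" for i using P' by simp
      show "(\<lambda>x. ennreal (indicator (P' i) (x $ i))) \<in> borel_measurable lborel" for i by measurable
    qed simp
    also have "\<dots> = (\<integral>\<^sup>+ x. ennreal (indicator \<Omega>' x) * indicator A x \<partial>lborel)"
    proof (rule nn_integral_cong)
      fix y :: "real^'n"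
      have "y $ i \<in> P' i" if "y \<in> \<Omega>'" for i using that U \<Omega>P img by fastforce
      then show "(\<Prod>i\<in>UNIV. ennreal (indicator (P' i) (y $ i))) * indicator (A \<inter> \<Omega>') y = ennreal (indicator \<Omega>' y) * indicator A y"
        by (auto simp: indicator_def)
    qed
    also have "\<dots> = emeasure ?N A" by (simp add: emeasure_density)
    finally show "emeasure ?M A = emeasure ?N A" .
  qed simp
qed

lemma set_integral_change_of_variables_coordinatewise:
  fixes F :: "real^'n \<Rightarrow> real"
  assumes \<Omega>: "\<Omega> \<in> sets borel" and \<Omega>': "\<Omega>' \<in> sets borel"
    and \<Omega>P: "\<Omega> \<subseteq> {x. \<forall>i. x $ i \<in> P i}" and U: "(\<lambda>x. \<chi> i. u i (x $ i)) ` \<Omega> = \<Omega>'"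
    and F: "F \<in> borel_measurable (restrict_space borel \<Omega>')"
  shows "set_integrable lborel \<Omega>' F \<longleftrightarrow>
      set_integrable lborel \<Omega> (\<lambda>x. F (\<chi> i. u i (x $ i)) * (\<Prod>i\<in>UNIV. u' i (x $ i)))"
    and "(LINT x:\<Omega>'|lborel. F x) = (LINT x:\<Omega>|lborel. F (\<chi> i. u i (x $ i)) * (\<Prod>i\<in>UNIV. u' i (x $ i)))"
proof -
  let ?G = "\<lambda>x. indicator \<Omega>' x *\<^sub>R F x"
  let ?j = "\<lambda>x :: real^'n. indicator \<Omega> x * (\<Prod>i\<in>UNIV. u' i (x $ i))"
  let ?U = "\<lambda>x. if x \<in> \<Omega> then \<chi> i. u i (x $ i) else 0"
  note cov = distr_density_jacobian[OF \<Omega> \<Omega>' \<Omega>P U]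
  have G[measurable]: "?G \<in> borel_measurable borel"
    using F \<Omega>' by (subst (asm) borel_measurable_restrict_space_iff) (auto simp: mult.commute)
  have j_nonneg: "0 \<le> ?j x" for x
    using pos \<Omega>P by (cases "x \<in> \<Omega>") (auto intro!: prod_nonneg)
  have GG: "indicator \<Omega>' x *\<^sub>R ?G x = ?G x" for x by (simp add: indicator_def)
  note GG' = GG[unfolded real_scaleR_def] and G' = G[unfolded real_scaleR_def]
  have pull: "?j x *\<^sub>R ?G (?U x) = indicator \<Omega> x *\<^sub>R (F (\<chi> i. u i (x $ i)) * (\<Prod>i\<in>UNIV. u' i (x $ i)))" for x
    using U by (auto simp: indicator_def)
  have I': "\<Omega>' \<in> sets lborel" using \<Omega>' by simp
  have "integrable lborel ?G \<longleftrightarrow> integrable (density lborel (\<lambda>x. ennreal (indicator \<Omega>' x))) ?G"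
    using \<Omega>' by (subst integrable_density) (auto simp: GG' G')
  also have "\<dots> \<longleftrightarrow> integrable (density lborel (\<lambda>x. ennreal (?j x))) (\<lambda>x. ?G (?U x))"
    unfolding cov(1)[symmetric] using cov(3) by (subst integrable_distr_eq) (auto simp: G')
  also have "\<dots> \<longleftrightarrow> integrable lborel (\<lambda>x. ?j x *\<^sub>R ?G (?U x))"
    using cov(2) measurable_compose[OF cov(3) G] j_nonneg by (subst integrable_density) auto
  finally show "set_integrable lborel \<Omega>' F \<longleftrightarrow>
      set_integrable lborel \<Omega> (\<lambda>x. F (\<chi> i. u i (x $ i)) * (\<Prod>i\<in>UNIV. u' i (x $ i)))"
    unfolding set_integrable_def pull .
  have "integral\<^sup>L lborel ?G = integral\<^sup>L (density lborel (\<lambda>x. ennreal (indicator \<Omega>' x))) ?G"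
    using \<Omega>' by (subst integral_density) (auto simp: GG' G')
  also have "\<dots> = integral\<^sup>L (density lborel (\<lambda>x. ennreal (?j x))) (\<lambda>x. ?G (?U x))"
    unfolding cov(1)[symmetric] using cov(3) by (subst integral_distr) (auto simp: G')
  also have "\<dots> = integral\<^sup>L lborel (\<lambda>x. ?j x *\<^sub>R ?G (?U x))"
    using cov(2) measurable_compose[OF cov(3) G] j_nonneg by (subst integral_density) auto
  finally show "(LINT x:\<Omega>'|lborel. F x) = (LINT x:\<Omega>|lborel. F (\<chi> i. u i (x $ i)) * (\<Prod>i\<in>UNIV. u' i (x $ i)))"
    unfolding set_lebesgue_integral_def pull .
qed

end

section \<open>Chain rule for weak gradients\<close>

lemma locally_integrable_on_borel_measurable:
  fixes f :: "real^'n \<Rightarrow> real"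
  assumes "open \<Omega>" "locally_integrable_on f \<Omega>"
  shows "f \<in> borel_measurable (restrict_space borel \<Omega>)"
proof -
  obtain C :: "nat \<Rightarrow> (real^'n) set" where C: "\<And>n. compact (C n)" "\<And>n. C n \<subseteq> \<Omega>" "\<Union>(range C) = \<Omega>"
    using open_Union_compact_subsets[OF assms(1)] by metis
  show ?thesis
  proof (rule measurable_piecewise_restrict[of "range C"])
    show "countable (range C)" by simp
    show "X \<inter> space (restrict_space borel \<Omega>) \<in> sets (restrict_space borel \<Omega>)" if "X \<in> range C" for X
      using that C(1,2) assms(1) by (auto simp: sets_restrict_space space_restrict_space borel_compact Int_absorb1 intro!: image_eqI[of _ _ X])
    show "space (restrict_space borel \<Omega>) \<subseteq> \<Union> (range C)"
      using C(3) by (auto simp: space_restrict_space)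
    fix X assume "X \<in> range C"
    then have X: "compact X" "X \<subseteq> \<Omega>" using C by auto
    then have "set_integrable lborel X f" using assms(2) by (simp add: locally_integrable_on_def)
    then have "(\<lambda>x. indicator X x *\<^sub>R f x) \<in> borel_measurable borel"
      unfolding set_integrable_def by (simp add: borel_measurable_integrable)
    then have "f \<in> borel_measurable (restrict_space borel X)"
      using X(1) by (subst borel_measurable_restrict_space_iff) (auto simp: borel_compact mult.commute)
    moreover have "restrict_space (restrict_space borel \<Omega>) X = restrict_space borel X"
      using X assms(1) by (subst restrict_restrict_space) (auto simp: borel_compact Int_absorb1)
    ultimately show "f \<in> borel_measurable (restrict_space (restrict_space borel \<Omega>) X)" by simp
  qed
qed

text \<open>A diffeomorphism \<open>\<Omega>' \<rightarrow> \<Omega>\<close> acting coordinatewise, with components \<open>\<tau> i\<close> and inverse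
  components \<open>\<sigma> i\<close>. The sets \<open>P i\<close> and \<open>P' i\<close> are the projections of \<open>\<Omega>\<close> and \<open>\<Omega>'\<close>.\<close>

locale coordinatewise_diffeo =
  fixes P P' :: "'n::finite \<Rightarrow> real set" and \<sigma> \<sigma>' \<tau> \<tau>' :: "'n \<Rightarrow> real \<Rightarrow> real"
    and \<Omega> \<Omega>' :: "(real^'n) set"
  assumes C1_\<sigma>: "coordinatewise_C1 P P' \<sigma> \<sigma>'" and C1_\<tau>: "coordinatewise_C1 P' P \<tau> \<tau>'"
    and open_\<Omega>: "open \<Omega>" and open_\<Omega>': "open \<Omega>'"
    and P_eq: "\<And>i. P i = (\<lambda>x. x $ i) ` \<Omega>" and P'_eq: "\<And>i. P' i = (\<lambda>x. x $ i) ` \<Omega>'"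
    and \<tau>_\<sigma>: "\<And>i t. t \<in> P i \<Longrightarrow> \<tau> i (\<sigma> i t) = t"
    and \<sigma>_image: "(\<lambda>y. \<chi> i. \<sigma> i (y $ i)) ` \<Omega> = \<Omega>'"
begin

interpretation s: coordinatewise_C1 P P' \<sigma> \<sigma>' by (rule C1_\<sigma>)
interpretation t: coordinatewise_C1 P' P \<tau> \<tau>' by (rule C1_\<tau>)

abbreviation "S \<equiv> (\<lambda>y :: real^'n. \<chi> i. \<sigma> i (y $ i))"
abbreviation "T \<equiv> (\<lambda>x :: real^'n. \<chi> i. \<tau> i (x $ i))"

lemma mem_P: "y \<in> \<Omega> \<Longrightarrow> y $ i \<in> P i" and mem_P': "x \<in> \<Omega>' \<Longrightarrow> x $ i \<in> P' i"
  by (auto simp: P_eq P'_eq)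

lemma T_S: "y \<in> \<Omega> \<Longrightarrow> T (S y) = y"
  using \<tau>_\<sigma> mem_P by (simp add: vec_eq_iff)

lemma T_image: "T ` \<Omega>' = \<Omega>"
  using T_S \<sigma>_image by (force simp: image_image)

lemma S_T: "x \<in> \<Omega>' \<Longrightarrow> S (T x) = x"
  using T_S \<sigma>_image by force

lemma \<tau>'_\<sigma>': assumes "t \<in> P i" shows "\<tau>' i (\<sigma> i t) * \<sigma>' i t = 1"
proof -
  have "\<sigma> i t \<in> P' i" using s.img assms by blast
  from DERIV_chain2[OF t.der[OF this] s.der[OF assms]]
  have "((\<lambda>t. \<tau> i (\<sigma> i t)) has_real_derivative \<tau>' i (\<sigma> i t) * \<sigma>' i t) (at t)" .
  moreover have "((\<lambda>t. \<tau> i (\<sigma> i t)) has_real_derivative 1) (at t)"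
    by (rule has_field_derivative_transform_within_open[OF DERIV_ident s.P assms]) (simp add: \<tau>_\<sigma>)
  ultimately show ?thesis by (rule DERIV_unique)
qed

lemma continuous_on_coord:
  assumes "continuous_on (P i) f" "A \<subseteq> \<Omega>"
  shows "continuous_on A (\<lambda>y. f (y $ i))"
  by (rule continuous_on_compose2[OF assms(1)]) (use assms(2) mem_P in \<open>auto intro!: continuous_intros\<close>)

lemma continuous_on_S: "A \<subseteq> \<Omega> \<Longrightarrow> continuous_on A S"
  by (intro continuous_on_vec_lambda continuous_on_coord s.u_cont)

lemma continuous_on_T: "A \<subseteq> \<Omega>' \<Longrightarrow> continuous_on A T"
  by (intro continuous_on_vec_lambda continuous_on_compose2[OF t.u_cont])
    (auto intro!: continuous_intros simp: mem_P')

lemma measurable_T: "T \<in> restrict_space borel \<Omega>' \<rightarrow>\<^sub>M restrict_space borel \<Omega>"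
proof (rule measurable_restrict_space2)
  show "T \<in> space (restrict_space borel \<Omega>') \<rightarrow> \<Omega>" using T_image by (auto simp: space_restrict_space)
  show "T \<in> restrict_space borel \<Omega>' \<rightarrow>\<^sub>M borel"
    by (rule borel_measurable_continuous_on_restrict[OF continuous_on_T]) simp
qed

lemma measurable_coord_\<tau>': "(\<lambda>x. \<tau>' i (x $ i)) \<in> borel_measurable (restrict_space borel \<Omega>')"
  by (rule borel_measurable_continuous_on_restrict[OF continuous_on_compose2[OF t.cont]])
    (auto intro!: continuous_intros simp: mem_P')

lemma locally_integrable_on_pullback:
  assumes f: "locally_integrable_on f \<Omega>" and c: "c \<in> borel_measurable (restrict_space borel \<Omega>')"
    and d: "continuous_on \<Omega> d" "\<And>y. y \<in> \<Omega> \<Longrightarrow> c (S y) = d y"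
  shows "locally_integrable_on (\<lambda>x. c x * f (T x)) \<Omega>'"
  unfolding locally_integrable_on_def
proof (intro allI impI)
  fix K' assume K': "compact K' \<and> K' \<subseteq> \<Omega>'"
  define K where "K = T ` K'"
  have K: "compact K" "K \<subseteq> \<Omega>"
    using K' compact_continuous_image[OF continuous_on_T] T_image by (auto simp: K_def)
  have SK: "S ` K = K'" using K' S_T by (force simp: K_def image_image)
  have "(\<lambda>x. c x * f (T x)) \<in> borel_measurable (restrict_space borel \<Omega>')"
    by (intro borel_measurable_times c
        measurable_compose[OF measurable_T locally_integrable_on_borel_measurable[OF open_\<Omega> f]])
  then have "(\<lambda>x. c x * f (T x)) \<in> borel_measurable (restrict_space borel K')"
    using K' by (rule_tac measurable_restrict_mono) auto
  then have "set_integrable lborel K' (\<lambda>x. c x * f (T x)) \<longleftrightarrow>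
    set_integrable lborel K (\<lambda>y. c (S y) * f (T (S y)) * (\<Prod>i\<in>UNIV. \<sigma>' i (y $ i)))"
    using K K' mem_P SK by (intro s.set_integral_change_of_variables_coordinatewise) (auto simp: borel_compact)
  also have "\<dots> \<longleftrightarrow> set_integrable lborel K (\<lambda>y. f y * (d y * (\<Prod>i\<in>UNIV. \<sigma>' i (y $ i))))"
    using K(2) by (intro set_integrable_cong refl) (auto simp: d(2) T_S[simplified] subset_iff)
  also have "\<dots>"
    using f K by (intro set_integrable_mult_continuous continuous_intros continuous_on_coord s.cont
        continuous_on_subset[OF d(1)]) (auto simp: locally_integrable_on_def)
  finally show "set_integrable lborel K' (\<lambda>x. c x * f (T x))" .
qed

text \<open>Substituting \<open>x = S y\<close> in the integral of \<open>(f \<circ> T) * \<partial>\<^sub>i\<phi>\<close> produces the Jacobian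
  \<open>\<Prod>j. \<sigma>\<^sub>j'(y\<^sub>j)\<close>, which need not be differentiable. However, \<open>\<sigma>\<^sub>i'(y\<^sub>i) * \<partial>\<^sub>i\<phi> (S y)\<close> is the \<open>i\<close>-th
  partial derivative of \<open>\<phi> \<circ> S\<close>, and the factors with \<open>j \<noteq> i\<close> do not depend on \<open>y\<^sub>i\<close>. So the
  integrand is \<open>f\<close> times the \<open>i\<close>-th partial derivative of a function \<open>w\<close> as in
  \<open>weak_gradient_nonsmooth_test\<close>.\<close>

lemma has_weak_gradient_compose:
  assumes fg: "has_weak_gradient \<Omega> f g"
  shows "has_weak_gradient \<Omega>' (\<lambda>x. f (T x)) (\<lambda>x. \<chi> i. \<tau>' i (x $ i) * g (T x) $ i)"
  unfolding has_weak_gradient_def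
proof (intro conjI allI impI)
  have f: "locally_integrable_on f \<Omega>" and g: "\<And>i. locally_integrable_on (\<lambda>x. g x $ i) \<Omega>"
    using fg by (auto simp: has_weak_gradient_def)
  show "locally_integrable_on (\<lambda>x. f (T x)) \<Omega>'"
    using locally_integrable_on_pullback[OF f, of "\<lambda>x. 1" "\<lambda>x. 1"] by simp
  fix i
  have "continuous_on \<Omega> (\<lambda>y. \<tau>' i (\<sigma> i (y $ i)))"
    using s.img mem_P by (intro continuous_on_compose2[OF t.cont] continuous_on_coord s.u_cont) auto
  from locally_integrable_on_pullback[OF g measurable_coord_\<tau>' this]
  show "locally_integrable_on (\<lambda>x. (\<chi> i. \<tau>' i (x $ i) * g (T x) $ i) $ i) \<Omega>'" by simp
  fix \<phi> assume \<phi>: "test_function_on \<Omega>' \<phi>"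
  then obtain K' where K': "compact K'" "K' \<subseteq> \<Omega>'" "\<And>x. x \<notin> K' \<Longrightarrow> \<phi> x = 0"
    and smooth: "\<And>k. C_k k \<phi>" by (auto simp: test_function_on_def)
  have \<phi>_cont: "continuous_on UNIV \<phi>" using smooth[of 0] by simp
  note \<phi>'_cont = continuous_partial_deriv_C_k[OF smooth, of i]
  have \<phi>_diff: "\<phi> differentiable (at x)" for x by (rule C_k_differentiable[OF smooth])
  have \<phi>'_supp: "partial_deriv i \<phi> x = 0" if "x \<notin> K'" for x
    by (rule partial_deriv_unique[OF \<phi>_diff has_partial_zero_open[of "- K'"]])
      (use that K' compact_imp_closed[OF K'(1)] in auto)
  define K where "K = T ` K'"
  have K: "compact K" "K \<subseteq> \<Omega>"
    using K' compact_continuous_image[OF continuous_on_T] T_image by (auto simp: K_def)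
  have SK: "S y \<notin> K'" if "y \<in> \<Omega>" "y \<notin> K" for y
    using that T_S[OF that(1)] by (force simp: K_def)
  let ?J = "\<lambda>y :: real^'n. \<Prod>j\<in>UNIV - {i}. \<sigma>' j (y $ j)"
  define w where "w y = (if y \<in> \<Omega> then \<phi> (S y) * ?J y else 0)" for y
  define h where "h y = (if y \<in> \<Omega> then partial_deriv i \<phi> (S y) * (\<Prod>j\<in>UNIV. \<sigma>' j (y $ j)) else 0)" for y
  have prod_split: "(\<Prod>j\<in>UNIV. \<sigma>' j (y $ j)) = \<sigma>' i (y $ i) * ?J y" for y :: "real^'n"
    by (simp add: prod.remove)
  have w_supp: "w y = 0" and h_supp: "h y = 0" if "y \<notin> K" for y
    using that SK K'(3) \<phi>'_supp by (auto simp: w_def h_def)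
  have cover: "UNIV = \<Omega> \<union> - K" and opK: "open (- K)"
    using K compact_imp_closed[OF K(1)] by auto
  have w_cont: "continuous_on UNIV w"
  proof (subst cover, rule continuous_on_open_Un[OF open_\<Omega> opK])
    have "continuous_on \<Omega> (\<lambda>y. \<phi> (S y) * ?J y)"
      by (intro continuous_intros continuous_on_coord s.cont continuous_on_compose2[OF \<phi>_cont] continuous_on_S) auto
    then show "continuous_on \<Omega> w" by (rule continuous_on_eq) (simp add: w_def)
    show "continuous_on (- K) w" by (rule continuous_on_eq[of _ "\<lambda>x. 0"]) (auto simp: w_supp)
  qed
  have h_cont: "continuous_on UNIV h"
  proof (subst cover, rule continuous_on_open_Un[OF open_\<Omega> opK])
    have "continuous_on \<Omega> (\<lambda>y. partial_deriv i \<phi> (S y) * (\<Prod>j\<in>UNIV. \<sigma>' j (y $ j)))"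
      by (intro continuous_intros continuous_on_coord s.cont continuous_on_compose2[OF \<phi>'_cont] continuous_on_S) auto
    then show "continuous_on \<Omega> h" by (rule continuous_on_eq) (simp add: h_def)
    show "continuous_on (- K) h" by (rule continuous_on_eq[of _ "\<lambda>x. 0"]) (auto simp: h_supp)
  qed
  have w_partial: "has_partial i w (h y) y" for y
  proof (cases "y \<in> \<Omega>")
    case False
    then have "y \<notin> K" using K by auto
    then show ?thesis using has_partial_zero_open[OF opK, of y w i] w_supp h_supp by auto
  next
    case True
    let ?r = "\<lambda>t. \<sigma> i (y $ i + t) - \<sigma> i (y $ i)"
    have 1: "((\<lambda>s. \<phi> (S y + s *\<^sub>R axis i 1)) has_real_derivative partial_deriv i \<phi> (S y)) (at (?r 0))"
      using has_partial_differentiable[OF \<phi>_diff, of i "S y"] by (simp add: has_partial_def)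
    have "((\<lambda>t. \<sigma> i (y $ i + t)) has_real_derivative \<sigma>' i (y $ i)) (at 0)"
      using s.der[OF mem_P[OF True]] DERIV_shift[of "\<sigma> i" "\<sigma>' i (y $ i)" 0 "y $ i"] by (simp add: add.commute)
    then have 2: "(?r has_real_derivative \<sigma>' i (y $ i)) (at 0)"
      by (auto intro!: derivative_eq_intros)
    from DERIV_cmult_right[OF DERIV_chain2[OF 1 2], of "?J y"]
    have D: "((\<lambda>t. \<phi> (S y + ?r t *\<^sub>R axis i 1) * ?J y) has_real_derivative h y) (at 0)"
      using True by (simp add: h_def prod_split mult.assoc)
    show ?thesis
      unfolding has_partial_def
    proof (rule has_field_derivative_transform_within_open[OF D])
      show "open ((\<lambda>t. y + t *\<^sub>R axis i 1) -` \<Omega>)" by (intro open_vimage open_\<Omega> continuous_intros)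
      show "0 \<in> (\<lambda>t. y + t *\<^sub>R axis i 1) -` \<Omega>" using True by simp
      fix t assume "t \<in> (\<lambda>t. y + t *\<^sub>R axis i 1) -` \<Omega>"
      moreover have "S (y + t *\<^sub>R axis i 1) = S y + ?r t *\<^sub>R axis i 1"
        by (auto simp: vec_eq_iff axis_def)
      moreover have "?J (y + t *\<^sub>R axis i 1) = ?J y"
        by (rule prod.cong) (auto simp: axis_def)
      ultimately show "\<phi> (S y + ?r t *\<^sub>R axis i 1) * ?J y = w (y + t *\<^sub>R axis i 1)"
        by (simp add: w_def)
    qed
  qed
  have cov: "(LINT x:\<Omega>'|lborel. F x) = (LINT y:\<Omega>|lborel. F (S y) * (\<Prod>i\<in>UNIV. \<sigma>' i (y $ i)))"
    if "F \<in> borel_measurable (restrict_space borel \<Omega>')" for F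
    using that open_\<Omega> open_\<Omega>' mem_P \<sigma>_image
    by (intro s.set_integral_change_of_variables_coordinatewise) auto
  have meas_cont: "u \<in> borel_measurable (restrict_space borel \<Omega>')" if "continuous_on UNIV u" for u :: "real^'n \<Rightarrow> real"
    by (rule borel_measurable_continuous_on_restrict[OF continuous_on_subset[OF that]]) simp
  have "(LINT x:\<Omega>'|lborel. f (T x) * partial_deriv i \<phi> x)
      = (LINT y:\<Omega>|lborel. f (T (S y)) * partial_deriv i \<phi> (S y) * (\<Prod>i\<in>UNIV. \<sigma>' i (y $ i)))"
    by (rule cov, intro borel_measurable_times meas_cont \<phi>'_cont
        measurable_compose[OF measurable_T locally_integrable_on_borel_measurable[OF open_\<Omega> f]])
  also have "\<dots> = (LINT y:\<Omega>|lborel. f y * h y)"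
    using open_\<Omega> by (intro set_lebesgue_integral_cong) (auto simp: h_def T_S[simplified])
  also have "\<dots> = - (LINT y:\<Omega>|lborel. g y $ i * w y)"
    by (rule weak_gradient_nonsmooth_test[OF open_\<Omega> fg K w_cont w_supp w_partial h_cont])
  also have "(LINT y:\<Omega>|lborel. g y $ i * w y)
      = (LINT y:\<Omega>|lborel. \<tau>' i (S y $ i) * g (T (S y)) $ i * \<phi> (S y) * (\<Prod>i\<in>UNIV. \<sigma>' i (y $ i)))"
  proof (rule set_lebesgue_integral_cong)
    show "\<Omega> \<in> sets lborel" using open_\<Omega> by simp
    show "\<forall>y. y \<in> \<Omega> \<longrightarrow> g y $ i * w y
        = \<tau>' i (S y $ i) * g (T (S y)) $ i * \<phi> (S y) * (\<Prod>i\<in>UNIV. \<sigma>' i (y $ i))"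
    proof (intro allI impI)
      fix y assume y: "y \<in> \<Omega>"
      have "\<tau>' i (S y $ i) * g (T (S y)) $ i * \<phi> (S y) * (\<Prod>i\<in>UNIV. \<sigma>' i (y $ i))
        = (\<tau>' i (\<sigma> i (y $ i)) * \<sigma>' i (y $ i)) * (g y $ i * (\<phi> (S y) * ?J y))"
        unfolding T_S[OF y] prod_split by (simp add: mult_ac)
      also have "\<dots> = g y $ i * w y" using y by (simp add: \<tau>'_\<sigma>' mem_P w_def)
      finally show "g y $ i * w y
        = \<tau>' i (S y $ i) * g (T (S y)) $ i * \<phi> (S y) * (\<Prod>i\<in>UNIV. \<sigma>' i (y $ i))" by (rule sym)
    qed
  qed
  also have "\<dots> = (LINT x:\<Omega>'|lborel. \<tau>' i (x $ i) * g (T x) $ i * \<phi> x)"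
    by (rule cov[symmetric], intro borel_measurable_times meas_cont \<phi>_cont measurable_coord_\<tau>'
        measurable_compose[OF measurable_T locally_integrable_on_borel_measurable[OF open_\<Omega> g]])
  finally show "(LINT x:\<Omega>'|lborel. f (T x) * partial_deriv i \<phi> x)
      = - (LINT x:\<Omega>'|lborel. (\<chi> i. \<tau>' i (x $ i) * g (T x) $ i) $ i * \<phi> x)" by simp
qed

end

section \<open>Marginal distribution functions\<close>

lemma not_AE_lborel_notin_open:
  fixes U :: "'a::euclidean_space set"
  assumes "open U" "U \<noteq> {}"
  shows "\<not> (AE x in lborel. x \<notin> U)"
proof
  assume "AE x in lborel. x \<notin> U"
  then have "U \<in> null_sets lborel"
    using assms(1) by (subst (asm) AE_iff_null_sets[symmetric]) auto
  then have "negligible U"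
    by (simp add: negligible_iff_null_sets null_sets_completionI)
  with open_not_negligible[OF assms] show False by simp
qed

locale positive_density =
  fixes \<Omega> :: "(real^'n) set" and \<mu> :: "(real^'n) measure" and \<rho> :: "'n \<Rightarrow> real \<Rightarrow> real"
  assumes open_\<Omega>: "open \<Omega>"
    and density: "prob_with_positive_density \<Omega> \<mu>"
    and marginals: "marginal_densities \<mu> \<rho>"
begin

sublocale p: prob_space \<mu> using density by (simp add: prob_with_positive_density_def)

lemma sets_\<mu>: "sets \<mu> = sets (restrict_space borel \<Omega>)"
  and space_\<mu>: "space \<mu> = \<Omega>"
  using density by (auto simp: prob_with_positive_density_def sets_restrict_space space_restrict_space)

lemma borel_measurable_\<mu>: "borel_measurable \<mu> = borel_measurable (restrict_space borel \<Omega>)"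
  by (rule measurable_cong_sets[OF sets_\<mu> refl])

lemma measurable_coord [measurable]: "(\<lambda>x. x $ i) \<in> borel_measurable \<mu>"
  unfolding borel_measurable_\<mu> by (intro borel_measurable_continuous_on_restrict continuous_intros)

lemma measurable_id_borel: "(\<lambda>x. x) \<in> \<mu> \<rightarrow>\<^sub>M borel"
  unfolding measurable_cong_sets[OF sets_\<mu> refl] by (intro borel_measurable_continuous_on_restrict continuous_intros)

lemma emeasure_open_pos:
  assumes "open U" "U \<inter> \<Omega> \<noteq> {}"
  shows "emeasure \<mu> (U \<inter> \<Omega>) \<noteq> 0"
proof
  assume z: "emeasure \<mu> (U \<inter> \<Omega>) = 0"
  obtain r where r: "r \<in> borel_measurable (restrict_space lborel \<Omega>)" "\<And>x. x \<in> \<Omega> \<Longrightarrow> 0 < r x"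
    "\<mu> = density (restrict_space lborel \<Omega>) (\<lambda>x. ennreal (r x))"
    using density by (auto simp: prob_with_positive_density_def)
  have "U \<inter> \<Omega> \<in> sets \<mu>"
    using assms open_\<Omega> by (auto simp: sets_\<mu> sets_restrict_space)
  with z have "U \<inter> \<Omega> \<in> null_sets \<mu>" by auto
  then have "AE x in restrict_space lborel \<Omega>. x \<in> U \<inter> \<Omega> \<longrightarrow> ennreal (r x) = 0"
    unfolding r(3) using r(1) by (subst (asm) null_sets_density_iff) auto
  then have "AE x in lborel. x \<in> \<Omega> \<longrightarrow> x \<in> U \<inter> \<Omega> \<longrightarrow> ennreal (r x) = 0"
    using open_\<Omega> by (subst (asm) AE_restrict_space_iff) auto
  then have "AE x in lborel. x \<notin> U \<inter> \<Omega>"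
    by eventually_elim (use r(2) in \<open>fastforce simp: ennreal_eq_0_iff\<close>)
  then show False using not_AE_lborel_notin_open[of "U \<inter> \<Omega>"] assms open_\<Omega> by auto
qed

definition marg :: "'n \<Rightarrow> real measure" where
  "marg i = density lborel (\<lambda>t. ennreal (\<rho> i t))"

abbreviation "I i \<equiv> {t. 0 < \<rho> i t}"
abbreviation "F \<equiv> marginal_cdf \<mu>"

lemma \<rho>_measurable [measurable]: "\<rho> i \<in> borel_measurable borel" and \<rho>_nonneg: "0 \<le> \<rho> i t"
  and open_I: "open (I i)" and interval_I: "is_interval (I i)"
  using marginals by (auto simp: marginal_densities_def)

lemma distr_coord: "distr \<mu> borel (\<lambda>x. x $ i) = marg i"
proof -
  have "distr \<mu> borel (\<lambda>x. x $ i) = distr \<mu> lborel (\<lambda>x. x $ i)" by (rule distr_cong) auto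
  also have "\<dots> = marg i"
    using marginals by (auto simp: marg_def marginal_densities_def intro: distributed_distr_eq_density)
  finally show ?thesis .
qed

lemma sets_marg [simp, measurable_cong]: "sets (marg i) = sets borel" and space_marg [simp]: "space (marg i) = UNIV"
  by (auto simp: marg_def)

lemma real_distribution_marg: "real_distribution (marg i)"
proof (intro real_distribution.intro real_distribution_axioms.intro)
  show "prob_space (marg i)" unfolding distr_coord[symmetric] by (rule p.prob_space_distr) measurable
qed simp

lemma marg_null_iff:
  assumes "A \<in> sets borel"
  shows "measure (marg i) A = 0 \<longleftrightarrow> (AE t in lborel. t \<notin> A \<inter> I i)"
proof -
  interpret real_distribution "marg i" by (rule real_distribution_marg)
  have "measure (marg i) A = 0 \<longleftrightarrow> A \<in> null_sets (marg i)"
    using assms by (simp add: emeasure_eq_measure null_sets_def)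
  also have "\<dots> \<longleftrightarrow> (AE t in lborel. t \<in> A \<longrightarrow> ennreal (\<rho> i t) = 0)"
    unfolding marg_def using assms by (subst null_sets_density_iff) auto
  also have "\<dots> \<longleftrightarrow> (AE t in lborel. t \<notin> A \<inter> I i)"
    using \<rho>_nonneg[of i] by (intro AE_cong) (auto simp: ennreal_eq_0_iff not_less)
  finally show ?thesis .
qed

lemma F_eq_cdf: "F i t = cdf (marg i) t"
  and isCont_F: "isCont (F i) t"
proof -
  interpret real_distribution "marg i" by (rule real_distribution_marg)
  have sing: "measure (marg i) {t} = 0" for t
    by (subst marg_null_iff) (simp, rule eventually_mono[OF AE_lborel_singleton[of t]], simp)
  show *: "F i t = cdf (marg i) t" for t
  proof -
    have "measure (marg i) ({..<t} \<union> {t}) = measure (marg i) {..<t} + measure (marg i) {t}"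
      by (rule finite_measure_Union) auto
    also have "{..<t} \<union> {t} = {..t}" by auto
    finally show ?thesis by (simp add: sing marginal_cdf_def distr_coord cdf_def)
  qed
  have "F i = cdf (marg i)" using * by auto
  then show "isCont (F i) t" using isCont_cdf[of t] sing by simp
qed

lemma F_mono: "s \<le> t \<Longrightarrow> F i s \<le> F i t"
proof -
  interpret real_distribution "marg i" by (rule real_distribution_marg)
  show "s \<le> t \<Longrightarrow> F i s \<le> F i t" by (simp add: F_eq_cdf cdf_nondecreasing)
qed

lemma F_bounds: "0 \<le> F i t" "F i t \<le> 1"
proof -
  interpret real_distribution "marg i" by (rule real_distribution_marg)
  show "0 \<le> F i t" "F i t \<le> 1" by (simp_all add: F_eq_cdf cdf_nonneg cdf_bounded_prob)
qed

lemma F_strict: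
  assumes "s \<in> I i" "s < t"
  shows "F i s < F i t"
proof (rule ccontr)
  interpret real_distribution "marg i" by (rule real_distribution_marg)
  assume "\<not> F i s < F i t"
  with F_mono[of s t i] assms(2) have "F i t - F i s = 0" by simp
  then have "measure (marg i) {s<..t} = 0" by (simp add: F_eq_cdf cdf_diff_eq assms(2))
  then have "AE u in lborel. u \<notin> {s<..t} \<inter> I i" by (subst (asm) marg_null_iff) auto
  then have null: "AE u in lborel. u \<notin> {s<..<t} \<inter> I i" by eventually_elim auto
  obtain e where e: "0 < e" "\<And>u. \<bar>u - s\<bar> < e \<Longrightarrow> u \<in> I i"
    using open_I[of i] assms(1) unfolding open_dist dist_real_def by blast
  have "{s<..<t} \<inter> I i \<noteq> {}"
  proof -
    have "s + min (e / 2) ((t - s) / 2) \<in> {s<..<t} \<inter> I i"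
      using e(1) assms(2) by (intro IntI e(2)) (auto simp: min_def field_simps)
    then show ?thesis by blast
  qed
  from not_AE_lborel_notin_open[OF open_Int[OF open_greaterThanLessThan open_I] this] null
  show False by blast
qed

lemma F_in_Ioo: assumes "t \<in> I i" shows "0 < F i t" "F i t < 1"
proof -
  obtain e where e: "0 < e" "\<And>u. \<bar>u - t\<bar> < e \<Longrightarrow> u \<in> I i"
    using open_I[of i] assms unfolding open_dist dist_real_def by blast
  have "F i (t - e / 2) < F i t" using e by (intro F_strict e(2)) auto
  then show "0 < F i t" using F_bounds[of i "t - e / 2"] by linarith
  have "F i t < F i (t + 1)" by (rule F_strict[OF assms]) simp
  then show "F i t < 1" using F_bounds[of i "t + 1"] by linarith
qed

text \<open>The positivity set is an interval, so one of the two half-lines cut off at \<open>t\<close> is a null set.\<close>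

lemma F_outside: assumes "t \<notin> I i" shows "F i t = 0 \<or> F i t = 1"
proof -
  interpret real_distribution "marg i" by (rule real_distribution_marg)
  have "{..<t} \<inter> I i = {} \<or> {t..} \<inter> I i = {}"
  proof (rule ccontr)
    assume "\<not> ?thesis"
    then obtain a b where "a \<in> I i" "a < t" "b \<in> I i" "t \<le> b" by auto
    then have "t \<in> I i" using interval_I[of i] unfolding is_interval_1 by (meson less_imp_le)
    then show False using assms by simp
  qed
  then have "measure (marg i) {..<t} = 0 \<or> measure (marg i) {t..} = 0"
    by (auto simp: marg_null_iff)
  moreover have "measure (marg i) {t..} = 1 - measure (marg i) {..<t}"
    using prob_compl[of "{..<t}"] by (simp add: Compl_eq_Diff_UNIV[symmetric] Compl_lessThan)
  ultimately show ?thesis by (auto simp: marginal_cdf_def distr_coord)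
qed

lemma F_surj: assumes "0 < u" "u < 1" obtains t where "t \<in> I i" "F i t = u"
proof -
  interpret real_distribution "marg i" by (rule real_distribution_marg)
  have Feq: "F i = cdf (marg i)" by (rule ext) (rule F_eq_cdf)
  have "eventually (\<lambda>t. F i t < u) at_bot" unfolding Feq by (rule order_tendstoD(2)[OF cdf_lim_at_bot assms(1)])
  then obtain a where a: "F i a < u" by (auto simp: eventually_at_bot_linorder)
  have "eventually (\<lambda>t. u < F i t) at_top" unfolding Feq by (rule order_tendstoD(1)[OF cdf_lim_at_top_prob assms(2)])
  then obtain b where b: "u < F i b" by (auto simp: eventually_at_top_linorder)
  have "a \<le> b" using a b F_mono[of b a i] by (cases "a \<le> b") auto
  then obtain t where t: "F i t = u"
    using IVT[of "F i" a u b] a b isCont_F by (auto intro: less_imp_le)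
  then have "t \<in> I i" using F_outside[of t i] assms by auto
  with t that show thesis by blast
qed

abbreviation "Q \<equiv> marginal_cdf_inv \<mu> \<rho>"

lemma Q_mem: assumes "0 < u" "u < 1" shows "Q i u \<in> I i" "F i (Q i u) = u"
proof -
  obtain t where "t \<in> I i" "F i t = u" using F_surj[OF assms] by blast
  then have "u \<in> F i ` I i" by blast
  then show "Q i u \<in> I i" "F i (Q i u) = u"
    unfolding marginal_cdf_inv_def by (rule inv_into_into, rule f_inv_into_f)
qed

lemma less_Q_iff:
  assumes "t \<in> I i" "0 < u" "u < 1"
  shows "t < Q i u \<longleftrightarrow> F i t < u"
  using F_strict[OF assms(1), of "Q i u"] F_strict[OF Q_mem(1)[OF assms(2,3), of i], of t] Q_mem(2)[OF assms(2,3), of i]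
  by (cases t "Q i u" rule: linorder_cases) auto

text \<open>Arbitrarily close to \<open>x\<^sub>i\<close> on either side there are intervals of positive marginal mass, because
  open subsets of \<open>\<Omega>\<close> have positive mass. So the positivity interval has points on both sides.\<close>

lemma coord_mem_I: assumes "x \<in> \<Omega>" shows "x $ i \<in> I i"
proof -
  interpret real_distribution "marg i" by (rule real_distribution_marg)
  obtain e where e: "0 < e" "ball x e \<subseteq> \<Omega>" using open_\<Omega> assms by (meson open_contains_ball)
  have key: "A \<inter> I i \<noteq> {}" if A: "open A" "x $ i + c \<in> A" and c: "\<bar>c\<bar> < e" for A c
  proof
    assume empty: "A \<inter> I i = {}"
    let ?U = "{y. y $ i \<in> A}"
    have "x + c *\<^sub>R axis i 1 \<in> \<Omega>" using e c by (auto simp: dist_norm)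
    moreover have "x + c *\<^sub>R axis i 1 \<in> ?U" using A(2) by simp
    ultimately have ne: "?U \<inter> \<Omega> \<noteq> {}" by blast
    have "open ?U"
      using open_vimage[OF A(1) linear_continuous_on[OF bounded_linear_vec_nth]]
      by (simp add: vimage_def)
    from emeasure_open_pos[OF this ne] have "emeasure (distr \<mu> borel (\<lambda>x. x $ i)) A \<noteq> 0"
      using A(1) by (subst emeasure_distr) (auto simp: space_\<mu> vimage_def Int_commute)
    then have "measure (marg i) A \<noteq> 0" by (simp add: distr_coord emeasure_eq_measure)
    then show False using A(1) empty by (subst (asm) marg_null_iff) auto
  qed
  obtain s where s: "s \<in> I i" "s < x $ i" using key[of "{..<x $ i}" "- e / 2"] e(1) by auto
  obtain t where t: "t \<in> I i" "x $ i < t" using key[of "{x $ i<..}" "e / 2"] e(1) by auto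
  show ?thesis using interval_I[of i] s t unfolding is_interval_1 by (meson less_imp_le)
qed

end

section \<open>The Nataf transformation transports the measures\<close>

lemma measure_eqI_joint_cdf:
  fixes M N :: "(real^'n) measure"
  assumes "finite_measure M" and M: "sets M = sets borel" and N: "sets N = sets borel"
    and eq: "\<And>a :: real^'n. emeasure M {x. \<forall>i. x $ i < a $ i} = emeasure N {x. \<forall>i. x $ i < a $ i}"
  shows "M = N"
proof -
  interpret finite_measure M by fact
  let ?E = "range (\<lambda>a :: real^'n. {x. \<forall>i. x $ i < a $ i})"
  have "eucl_less x a \<longleftrightarrow> (\<forall>i. x $ i < a $ i)" for x a :: "real^'n"
    by (auto simp: eucl_less_def Basis_vec_def inner_axis)
  then have "borel = sigma UNIV ?E"
    using borel_eq_lessThan[where 'a = "real^'n"] by simp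
  then have "sets borel = sets (sigma UNIV ?E)" by (rule arg_cong)
  then have borel: "sets borel = sigma_sets UNIV ?E" using sets_measure_of[of ?E UNIV] by simp
  show ?thesis
  proof (rule measure_eqI_generator_eq[where A = "\<lambda>k. {x. \<forall>i. x $ i < real k}"])
    show "Int_stable ?E"
    proof (rule Int_stableI_image)
      fix a b :: "real^'n"
      show "\<exists>c\<in>UNIV. {x. \<forall>i. x $ i < a $ i} \<inter> {x. \<forall>i. x $ i < b $ i} = {x. \<forall>i. x $ i < c $ i}"
        by (intro bexI[of _ "\<chi> i. min (a $ i) (b $ i)"]) auto
    qed
    show "range (\<lambda>k. {x :: real^'n. \<forall>i. x $ i < real k}) \<subseteq> ?E"
    proof safe
      fix k
      show "{x. \<forall>i. x $ i < real k} \<in> ?E" by (rule image_eqI[of _ _ "\<chi> i. real k"]) auto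
    qed
    show "(\<Union>k. {x :: real^'n. \<forall>i. x $ i < real k}) = UNIV"
    proof safe
      fix x :: "real^'n"
      obtain k where "norm x < real k" using reals_Archimedean2 by blast
      then have "x $ i < real k" for i using component_le_norm_cart[of x i] by linarith
      then show "x \<in> (\<Union>k. {x. \<forall>i. x $ i < real k})" by blast
    qed simp
  qed (use M N borel eq in auto)
qed

locale nataf_transport =
  m: positive_density \<Omega> \<mu> \<rho> + m': positive_density \<Omega>' \<mu>' \<rho>'
  for \<Omega> \<Omega>' :: "(real^'n) set" and \<mu> \<mu>' :: "(real^'n) measure" and \<rho> \<rho>' :: "'n \<Rightarrow> real \<Rightarrow> real" +
  assumes copula: "same_copula \<mu> \<mu>'"
    and diffeo: "diffeomorphism_with_inverse \<Omega>' \<Omega> (nataf \<mu>' \<mu> \<rho>) (nataf \<mu> \<mu>' \<rho>')"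
begin

abbreviation "T \<equiv> nataf \<mu>' \<mu> \<rho>"
abbreviation "S \<equiv> nataf \<mu> \<mu>' \<rho>'"
abbreviation "\<tau> \<equiv> nataf_coord \<mu>' \<mu> \<rho>"
abbreviation "\<sigma> \<equiv> nataf_coord \<mu> \<mu>' \<rho>'"

lemma homeo: "homeomorphism \<Omega>' \<Omega> T S" and C1_T: "C1_map_on \<Omega>' T" and C1_S: "C1_map_on \<Omega> S"
  using diffeo by (auto simp: diffeomorphism_with_inverse_def)

lemma \<tau>_mem: "t \<in> m'.I i \<Longrightarrow> \<tau> i t \<in> m.I i" and F_\<tau>: "t \<in> m'.I i \<Longrightarrow> m.F i (\<tau> i t) = m'.F i t"
  using m.Q_mem[OF m'.F_in_Ioo, of t i i] by (auto simp: nataf_coord_def)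

lemma measurable_T: "T \<in> \<mu>' \<rightarrow>\<^sub>M \<mu>"
proof -
  have "T \<in> restrict_space borel \<Omega>' \<rightarrow>\<^sub>M restrict_space borel \<Omega>"
    using homeo by (intro measurable_restrict_space2 borel_measurable_continuous_on_restrict)
      (auto simp: homeomorphism_def space_restrict_space)
  then show ?thesis by (simp add: measurable_cong_sets[OF m'.sets_\<mu> m.sets_\<mu>])
qed

lemma measurable_T_borel: "T \<in> \<mu>' \<rightarrow>\<^sub>M borel"
  using measurable_compose[OF measurable_T m.measurable_id_borel] .

text \<open>At points whose marginal levels \<open>u\<^sub>i\<close> all lie in \<open>(0, 1)\<close> both joint distribution functions
  are \<open>C u\<close> for the common copula \<open>C\<close>, because \<open>T\<close> preserves marginal levels.\<close>

lemma emeasure_quadrant: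
  assumes "\<And>i. 0 < u $ i" "\<And>i. u $ i < 1"
  shows "emeasure \<mu> {x\<in>\<Omega>. \<forall>i. x $ i < m.Q i (u $ i)} = emeasure \<mu>' {x\<in>\<Omega>'. \<forall>i. T x $ i < m.Q i (u $ i)}"
proof -
  obtain C where C: "is_copula_of C \<mu>" "is_copula_of C \<mu>'" using copula by (auto simp: same_copula_def)
  have "measure \<mu> {x\<in>\<Omega>. \<forall>i. x $ i < m.Q i (u $ i)} = joint_cdf \<mu> (\<chi> i. m.Q i (u $ i))"
    unfolding joint_cdf_def by (rule arg_cong[of _ _ "measure \<mu>"]) (auto simp: m.space_\<mu>)
  also have "\<dots> = C u"
    using C(1) m.Q_mem(2)[OF assms] by (simp add: is_copula_of_def vec_lambda_eta)
  also have "\<dots> = joint_cdf \<mu>' (\<chi> i. m'.Q i (u $ i))"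
    using C(2) m'.Q_mem(2)[OF assms] by (simp add: is_copula_of_def vec_lambda_eta)
  also have "\<dots> = measure \<mu>' {x\<in>\<Omega>'. \<forall>i. x $ i < m'.Q i (u $ i)}"
    unfolding joint_cdf_def by (rule arg_cong[of _ _ "measure \<mu>'"]) (auto simp: m'.space_\<mu>)
  also have "{x\<in>\<Omega>'. \<forall>i. x $ i < m'.Q i (u $ i)} = {x\<in>\<Omega>'. \<forall>i. T x $ i < m.Q i (u $ i)}"
  proof -
    have "x $ i < m'.Q i (u $ i) \<longleftrightarrow> T x $ i < m.Q i (u $ i)" if "x \<in> \<Omega>'" for x i
      using m'.less_Q_iff[OF m'.coord_mem_I[OF that] assms] m.less_Q_iff[OF \<tau>_mem[OF m'.coord_mem_I[OF that]] assms]
        F_\<tau>[OF m'.coord_mem_I[OF that]] by (simp add: nataf_def)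
    then show ?thesis by auto
  qed
  finally show ?thesis by (simp add: m.p.emeasure_eq_measure m'.p.emeasure_eq_measure)
qed

text \<open>It remains to pass from the quadrants of \<open>emeasure_quadrant\<close> to arbitrary ones. A level
  \<open>F\<^sub>i(a\<^sub>i) = 0\<close> makes the quadrant null for both measures, and levels in \<open>(0, 1]\<close> are limits from below
  of levels in \<open>(0, 1)\<close>.\<close>

lemma distr_T: "distr \<mu>' \<mu> T = \<mu>"
proof -
  let ?M = "distr \<mu> borel (\<lambda>x. x)" and ?N = "distr \<mu>' borel T"
  have T_mem: "T x \<in> \<Omega>" if "x \<in> \<Omega>'" for x using homeo that by (auto simp: homeomorphism_def)
  have quad[measurable]: "{x :: real^'n. \<forall>i. x $ i < a $ i} \<in> sets borel" for a by measurable
  have "?M = ?N"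
  proof (rule measure_eqI_joint_cdf)
    show "finite_measure ?M" by (rule m.p.finite_measure_distr[OF m.measurable_id_borel])
    fix a :: "real^'n"
    have M: "emeasure ?M {x. \<forall>i. x $ i < b $ i} = emeasure \<mu> {x\<in>\<Omega>. \<forall>i. x $ i < b $ i}" for b
      by (subst emeasure_distr[OF m.measurable_id_borel quad])
        (auto simp: m.space_\<mu> intro!: arg_cong[of _ _ "emeasure \<mu>"])
    have N: "emeasure ?N {x. \<forall>i. x $ i < b $ i} = emeasure \<mu>' {x\<in>\<Omega>'. \<forall>i. T x $ i < b $ i}" for b
      by (subst emeasure_distr[OF measurable_T_borel quad])
        (auto simp: m'.space_\<mu> intro!: arg_cong[of _ _ "emeasure \<mu>'"])
    show "emeasure ?M {x. \<forall>i. x $ i < a $ i} = emeasure ?N {x. \<forall>i. x $ i < a $ i}"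
    proof (cases "\<forall>i. 0 < m.F i (a $ i)")
      case False
      then obtain i where "m.F i (a $ i) = 0" using m.F_bounds(1) by (metis less_le)
      \<comment> \<open>then \<open>a\<^sub>i\<close> lies to the left of the \<open>i\<close>-th projection of \<open>\<Omega>\<close>\<close>
      then have "a $ i \<le> x $ i" if "x \<in> \<Omega>" for x
        using m.F_mono[of "x $ i" "a $ i" i] m.F_in_Ioo[OF m.coord_mem_I[OF that], of i] by (cases "a $ i \<le> x $ i") auto
      then have empty: "{x\<in>\<Omega>. \<forall>i. x $ i < a $ i} = {}" "{x\<in>\<Omega>'. \<forall>i. T x $ i < a $ i} = {}"
        using T_mem by (auto simp: not_less[symmetric])
      show ?thesis unfolding M N empty by simp
    next
      case True
      \<comment> \<open>\<open>c k\<close> increases to \<open>1\<close>; the factor keeps the levels \<open>u k\<close> away from \<open>1\<close>\<close>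
      define c where "c k = 1 - 1 / (real k + 2)" for k :: nat
      have c: "0 < c k" "c k < 1" for k by (auto simp: c_def field_simps)
      define u where "u k = (\<chi> i. c k * m.F i (a $ i))" for k
      have u: "0 < u k $ i" "u k $ i < 1" for k i
      proof -
        show "0 < u k $ i" using c True by (simp add: u_def)
        have "c k * m.F i (a $ i) \<le> c k * 1" using c(1)[of k] m.F_bounds by (intro mult_left_mono) auto
        then show "u k $ i < 1" using c(2)[of k] by (simp add: u_def)
      qed
      have Q_iff: "t < m.Q i (u k $ i) \<longleftrightarrow> m.F i t < c k * m.F i (a $ i)" if "t \<in> m.I i" for t i k
        using m.less_Q_iff[OF that u] by (simp add: u_def)
      let ?B = "\<lambda>k. {x. \<forall>i. x $ i < m.Q i (u k $ i)}"
      have c_mono: "c k \<le> c l" if "k \<le> l" for k l using that by (auto simp: c_def field_simps)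
      have inc: "m.F i t < c k * m.F i (a $ i) \<Longrightarrow> k \<le> l \<Longrightarrow> m.F i t < c l * m.F i (a $ i)" for t i k l
        using mult_right_mono[OF c_mono[of k l] m.F_bounds(1)[of i "a $ i"]] by simp
      have c_lim: "c \<longlonglongrightarrow> 1"
      proof -
        have "(\<lambda>k. 1 - 1 / real (k + 2)) \<longlonglongrightarrow> 1 - 0"
          by (intro tendsto_diff tendsto_const LIMSEQ_ignore_initial_segment[OF lim_1_over_n])
        then show ?thesis by (simp add: c_def[abs_def] add.commute)
      qed
      have exhaust: "(\<forall>i. z $ i < a $ i) \<longleftrightarrow> (\<exists>k. \<forall>i. z $ i < m.Q i (u k $ i))" if z: "z \<in> \<Omega>" for z
      proof -
        note zI = m.coord_mem_I[OF z]
        show ?thesis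
        proof
          assume less: "\<forall>i. z $ i < a $ i"
          have "eventually (\<lambda>k. m.F i (z $ i) < c k * m.F i (a $ i)) sequentially" for i
          proof -
            have "(\<lambda>k. c k * m.F i (a $ i)) \<longlonglongrightarrow> 1 * m.F i (a $ i)" by (intro tendsto_intros c_lim)
            moreover have "m.F i (z $ i) < m.F i (a $ i)" using less by (intro m.F_strict zI) auto
            ultimately show ?thesis by (simp add: order_tendstoD)
          qed
          then have "eventually (\<lambda>k. \<forall>i. m.F i (z $ i) < c k * m.F i (a $ i)) sequentially"
            by (simp add: eventually_all_finite)
          then show "\<exists>k. \<forall>i. z $ i < m.Q i (u k $ i)"
            by (auto simp: Q_iff[OF zI] eventually_sequentially)
        next
          assume "\<exists>k. \<forall>i. z $ i < m.Q i (u k $ i)"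
          then obtain k where k: "\<And>i. m.F i (z $ i) < c k * m.F i (a $ i)" using Q_iff[OF zI] by auto
          have "c k * m.F i (a $ i) \<le> 1 * m.F i (a $ i)" for i
            using c(2)[of k] m.F_bounds by (intro mult_right_mono) auto
          then have "m.F i (z $ i) < m.F i (a $ i)" for i using k[of i] by (metis less_le_trans mult_1)
          then show "\<forall>i. z $ i < a $ i" using m.F_mono by (meson not_less)
        qed
      qed
      have inc_z: "(\<forall>i. z $ i < m.Q i (u k $ i)) \<Longrightarrow> k \<le> l \<Longrightarrow> (\<forall>i. z $ i < m.Q i (u l $ i))" if "z \<in> \<Omega>" for z k l
        unfolding Q_iff[OF m.coord_mem_I[OF that]] by (blast intro: inc)
      have "emeasure \<mu> {x\<in>\<Omega>. \<forall>i. x $ i < a $ i} = emeasure \<mu> (\<Union>k. {x\<in>\<Omega>. \<forall>i. x $ i < m.Q i (u k $ i)})"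
        using exhaust by (intro arg_cong[of _ _ "emeasure \<mu>"]) auto
      also have "\<dots> = (SUP k. emeasure \<mu> {x\<in>\<Omega>. \<forall>i. x $ i < m.Q i (u k $ i)})"
      proof (rule SUP_emeasure_incseq[symmetric])
        have "{x\<in>\<Omega>. \<forall>i. x $ i < m.Q i (u k $ i)} = (\<lambda>x. x) -` ?B k \<inter> space \<mu>" for k
          by (auto simp: m.space_\<mu>)
        moreover have "?B k \<in> sets borel" for k using quad[of "\<chi> i. m.Q i (u k $ i)"] by simp
        ultimately show "range (\<lambda>k. {x\<in>\<Omega>. \<forall>i. x $ i < m.Q i (u k $ i)}) \<subseteq> sets \<mu>"
          using measurable_sets[OF m.measurable_id_borel] by auto
        show "incseq (\<lambda>k. {x\<in>\<Omega>. \<forall>i. x $ i < m.Q i (u k $ i)})"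
          unfolding incseq_def using inc_z by blast
      qed
      also have "\<dots> = (SUP k. emeasure \<mu>' {x\<in>\<Omega>'. \<forall>i. T x $ i < m.Q i (u k $ i)})"
        by (intro SUP_cong refl emeasure_quadrant u)
      also have "\<dots> = emeasure \<mu>' (\<Union>k. {x\<in>\<Omega>'. \<forall>i. T x $ i < m.Q i (u k $ i)})"
      proof (rule SUP_emeasure_incseq)
        have "{x\<in>\<Omega>'. \<forall>i. T x $ i < m.Q i (u k $ i)} = T -` ?B k \<inter> space \<mu>'" for k
          by (auto simp: m'.space_\<mu>)
        moreover have "T -` ?B k \<inter> space \<mu>' \<in> sets \<mu>'" for k
          using measurable_sets[OF measurable_T_borel quad[of "\<chi> i. m.Q i (u k $ i)"]] by simp
        ultimately show "range (\<lambda>k. {x\<in>\<Omega>'. \<forall>i. T x $ i < m.Q i (u k $ i)}) \<subseteq> sets \<mu>'"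
          by (simp only:) blast
        show "incseq (\<lambda>k. {x\<in>\<Omega>'. \<forall>i. T x $ i < m.Q i (u k $ i)})"
          unfolding incseq_def using inc_z[OF T_mem] by blast
      qed
      also have "\<dots> = emeasure \<mu>' {x\<in>\<Omega>'. \<forall>i. T x $ i < a $ i}"
        using exhaust[OF T_mem] by (intro arg_cong[of _ _ "emeasure \<mu>'"]) auto
      finally show ?thesis unfolding M N .
    qed
  qed auto
  show ?thesis
  proof (rule measure_eqI)
    fix A assume "A \<in> sets (distr \<mu>' \<mu> T)"
    then have A: "A \<in> sets \<mu>" by simp
    then have A': "A \<in> sets borel" "A \<subseteq> \<Omega>"
      using m.open_\<Omega> by (auto simp: m.sets_\<mu> sets_restrict_space)
    have "emeasure (distr \<mu>' \<mu> T) A = emeasure \<mu>' (T -` A \<inter> space \<mu>')"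
      by (rule emeasure_distr[OF measurable_T A])
    also have "\<dots> = emeasure ?N A" by (rule emeasure_distr[OF measurable_T_borel A'(1), symmetric])
    also have "\<dots> = emeasure ?M A" by (simp only: \<open>?M = ?N\<close>)
    also have "\<dots> = emeasure \<mu> A"
      using A' by (subst emeasure_distr[OF m.measurable_id_borel]) (auto simp: m.space_\<mu> Int_absorb2)
    finally show "emeasure (distr \<mu>' \<mu> T) A = emeasure \<mu> A" .
  qed simp
qed

end

section \<open>The Nataf transformation as a coordinatewise diffeomorphism\<close>

text \<open>Every \<open>t\<close> in the projection is the \<open>i\<close>-th coordinate of some \<open>x\<close> in \<open>U\<close>; restricting \<open>T\<close> to the line
  through \<open>x\<close> parallel to the \<open>i\<close>-th axis recovers \<open>\<tau> i\<close> near \<open>t\<close>.\<close>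

lemma C1_map_on_coordinatewise:
  fixes U :: "(real^'n) set"
  assumes U: "open U" and T: "\<And>x i. T x $ i = \<tau> i (x $ i)" and C1: "C1_map_on U T"
    and t: "t \<in> (\<lambda>x. x $ i) ` U"
  shows "(\<tau> i has_real_derivative deriv (\<tau> i) t) (at t)" (is ?der)
    and "isCont (deriv (\<tau> i)) t" (is ?cont)
proof -
  obtain T' where T': "\<And>x. x \<in> U \<Longrightarrow> (T has_derivative blinfun_apply (T' x)) (at x)" "continuous_on U T'"
    using C1 by (auto simp: C1_map_on_def)
  have der: "(\<tau> i has_real_derivative blinfun_apply (T' x) (axis i 1) $ i) (at (x $ i))" if x: "x \<in> U" for x
  proof -
    have 1: "((\<lambda>s. x + (s - x $ i) *\<^sub>R axis i 1) has_derivative (\<lambda>s. s *\<^sub>R axis i 1)) (at (x $ i))"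
      by (auto intro!: derivative_eq_intros)
    have 2: "(T has_derivative blinfun_apply (T' x)) (at (x + (x $ i - x $ i) *\<^sub>R axis i 1))"
      using T'(1)[OF x] by simp
    from bounded_linear.has_derivative[OF bounded_linear_vec_nth[of i] has_derivative_compose[OF 1 2]]
    have "(\<tau> i has_derivative (\<lambda>s. blinfun_apply (T' x) (s *\<^sub>R axis i 1) $ i)) (at (x $ i))"
      by (simp add: T)
    then show ?thesis
      by (simp add: has_field_derivative_def blinfun.scaleR_right mult_commute_abs)
  qed
  obtain x where x: "x \<in> U" "t = x $ i" using t by auto
  have deriv_eq: "deriv (\<tau> i) (y $ i) = blinfun_apply (T' y) (axis i 1) $ i" if "y \<in> U" for y
    by (rule DERIV_imp_deriv[OF der[OF that]])
  show ?der using der[OF x(1)] deriv_eq[OF x(1)] x(2) by simp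
  let ?line = "\<lambda>s. x + (s - t) *\<^sub>R axis i 1"
  let ?V = "?line -` U"
  have V: "open ?V" "t \<in> ?V" using U x by (auto intro!: open_vimage continuous_intros)
  have "continuous_on ?V (\<lambda>s. blinfun_apply (T' (?line s)) (axis i 1) $ i)"
    by (intro continuous_intros continuous_on_compose2[OF T'(2)]) auto
  then have "continuous_on ?V (deriv (\<tau> i))"
  proof (rule continuous_on_eq)
    fix s assume "s \<in> ?V"
    then show "blinfun_apply (T' (?line s)) (axis i 1) $ i = deriv (\<tau> i) s"
      using deriv_eq[of "?line s"] x(2) by simp
  qed
  then show ?cont using V by (simp add: continuous_on_eq_continuous_at)
qed

lemma nonneg_deriv_of_mono:
  fixes f :: "real \<Rightarrow> real"
  assumes "open P" "t \<in> P" "(f has_real_derivative d) (at t)" "\<And>s. s \<in> P \<Longrightarrow> t < s \<Longrightarrow> f t \<le> f s"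
  shows "0 \<le> d"
proof (rule ccontr)
  assume "\<not> 0 \<le> d"
  then obtain e where e: "0 < e" "\<And>h. 0 < h \<Longrightarrow> h < e \<Longrightarrow> f (t + h) < f t"
    using DERIV_neg_dec_right[OF assms(3)] by auto
  obtain r where r: "0 < r" "\<And>s. \<bar>s - t\<bar> < r \<Longrightarrow> s \<in> P"
    using assms(1,2) unfolding open_dist dist_real_def by blast
  define h where "h = min e r / 2"
  have "0 < h" "h < e" "h < r" using e(1) r(1) by (auto simp: h_def min_def)
  with e(2)[of h] assms(4)[of "t + h"] r(2)[of "t + h"] show False by simp
qed

lemma nataf_transport_swap:
  assumes "nataf_transport \<Omega> \<Omega>' \<mu> \<mu>' \<rho> \<rho>'"
  shows "nataf_transport \<Omega>' \<Omega> \<mu>' \<mu> \<rho>' \<rho>"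
proof -
  interpret nataf_transport \<Omega> \<Omega>' \<mu> \<mu>' \<rho> \<rho>' by fact
  have "same_copula \<mu>' \<mu>" using copula by (auto simp: same_copula_def)
  moreover have "diffeomorphism_with_inverse \<Omega> \<Omega>' S T"
    using diffeo by (simp add: diffeomorphism_with_inverse_def homeomorphism_symD)
  ultimately show ?thesis
    by (intro nataf_transport.intro nataf_transport_axioms.intro m.positive_density_axioms m'.positive_density_axioms)
qed

context nataf_transport
begin

abbreviation "P i \<equiv> (\<lambda>x. x $ i) ` \<Omega>"
abbreviation "P' i \<equiv> (\<lambda>x. x $ i) ` \<Omega>'"

lemma T_nth: "T x $ i = \<tau> i (x $ i)" by (simp add: nataf_def)

text \<open>\<open>\<tau> i\<close> matches the levels of two distribution functions, and the one of \<open>\<mu>\<close> is strictly increasing.\<close>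

lemma \<tau>_mono: assumes "s \<in> P' i" "t \<in> P' i" "s < t" shows "\<tau> i s \<le> \<tau> i t"
proof (rule ccontr)
  have st: "s \<in> m'.I i" "t \<in> m'.I i" using assms m'.coord_mem_I by auto
  assume "\<not> \<tau> i s \<le> \<tau> i t"
  then have "m.F i (\<tau> i t) < m.F i (\<tau> i s)" using m.F_strict[OF \<tau>_mem[OF st(2)]] by auto
  then have "m'.F i t < m'.F i s" by (simp only: F_\<tau> st)
  with m'.F_mono[of s t i] assms(3) show False by simp
qed

lemma \<sigma>_\<tau>: "t \<in> P' i \<Longrightarrow> \<sigma> i (\<tau> i t) = t"
proof -
  assume "t \<in> P' i"
  then obtain x where x: "x \<in> \<Omega>'" "t = x $ i" by auto
  then have "\<sigma> i (\<tau> i t) = S (T x) $ i" by (simp add: nataf_def)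
  also have "S (T x) = x" using homeo x(1) by (simp add: homeomorphism_def)
  finally show ?thesis using x(2) by simp
qed

lemma coordinatewise_C1_\<tau>: "coordinatewise_C1 P' P \<tau> (\<lambda>i. deriv (\<tau> i))"
proof
  fix i
  show "open (P' i)" "open (P i)" using open_image_vec_nth m.open_\<Omega> m'.open_\<Omega> by auto
  note C1 = C1_map_on_coordinatewise[OF m'.open_\<Omega> T_nth C1_T]
  show "(\<tau> i has_real_derivative deriv (\<tau> i) t) (at t)" if "t \<in> P' i" for t by (rule C1(1)[OF that])
  then show "0 \<le> deriv (\<tau> i) t" if "t \<in> P' i" for t
    using nonneg_deriv_of_mono[of "P' i" t "\<tau> i"] \<tau>_mono[OF that] that \<open>open (P' i)\<close> by blast
  show "continuous_on (P' i) (deriv (\<tau> i))" by (rule continuous_at_imp_continuous_on) (use C1(2) in blast)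
  show "inj_on (\<tau> i) (P' i)" by (rule inj_on_inverseI) (rule \<sigma>_\<tau>)
  have "T ` \<Omega>' = \<Omega>" using homeo by (simp add: homeomorphism_def)
  then show "\<tau> i ` P' i = P i" by (force simp: image_image T_nth[symmetric])
qed

lemma coordinatewise_C1_\<sigma>: "coordinatewise_C1 P P' \<sigma> (\<lambda>i. deriv (\<sigma> i))"
  by (rule nataf_transport.coordinatewise_C1_\<tau>[OF nataf_transport_swap[OF nataf_transport_axioms]])

lemma \<tau>_\<sigma>: "t \<in> P i \<Longrightarrow> \<tau> i (\<sigma> i t) = t"
  by (rule nataf_transport.\<sigma>_\<tau>[OF nataf_transport_swap[OF nataf_transport_axioms]])

lemma coordinatewise_diffeo:
  "coordinatewise_diffeo P P' \<sigma> (\<lambda>i. deriv (\<sigma> i)) \<tau> (\<lambda>i. deriv (\<tau> i)) \<Omega> \<Omega>'"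
proof (intro coordinatewise_diffeo.intro coordinatewise_C1_\<sigma> coordinatewise_C1_\<tau> m.open_\<Omega> m'.open_\<Omega> refl)
  show "\<tau> i (\<sigma> i t) = t" if "t \<in> P i" for i t by (rule \<tau>_\<sigma>[OF that])
  have "S ` \<Omega> = \<Omega>'" using homeo by (simp add: homeomorphism_def)
  then show "(\<lambda>y. \<chi> i. \<sigma> i (y $ i)) ` \<Omega> = \<Omega>'" by (simp add: nataf_def[abs_def])
qed

section \<open>The diagonal matrix and the transported inequality\<close>

text \<open>Both sides are densities of the \<open>i\<close>-th marginal of \<open>\<mu>\<close>: by \<open>distr_T\<close> that marginal is the image of
  the \<open>i\<close>-th marginal of \<open>\<mu>'\<close> under \<open>\<tau> i\<close>, and substituting \<open>t = \<sigma> i s\<close> gives its density. In general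
  the two densities agree only outside a null set.\<close>

lemma marginal_density_transport:
  "AE s in lborel. s \<in> P i \<longrightarrow> \<rho> i s = \<rho>' i (\<sigma> i s) * deriv (\<sigma> i) s"
proof -
  interpret s: coordinatewise_C1 P P' \<sigma> "\<lambda>i. deriv (\<sigma> i)" by (rule coordinatewise_C1_\<sigma>)
  let ?ds = "\<lambda>s. if s \<in> P i then deriv (\<sigma> i) s else 0" and ?s = "\<lambda>s. if s \<in> P i then \<sigma> i s else 0"
  let ?t = "\<lambda>t. if t \<in> P' i then \<tau> i t else 0"
  have meas[measurable]: "?ds \<in> borel_measurable borel" "?s \<in> borel_measurable borel"
    by (rule measurable_on_open_extension[OF s.P s.cont], rule measurable_on_open_extension[OF s.P s.u_cont])
  have [measurable]: "?t \<in> borel_measurable borel"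
    using coordinatewise_C1.u_cont[OF coordinatewise_C1_\<tau>] s.P' by (intro measurable_on_open_extension)
  have [measurable]: "P i \<in> sets borel" "P' i \<in> sets borel" using s.P s.P' by auto
  have cov: "distr (density lborel (\<lambda>t. ennreal (?ds t))) borel ?s = density lborel (\<lambda>t. ennreal (indicator (P' i) t))"
    by (rule distr_density_deriv_1D[OF s.P s.P' s.der s.pos s.cont s.inj s.img])
  have "AE s in lborel. ennreal (\<rho> i s) = ennreal (?ds s * \<rho>' i (?s s))"
  proof (rule sigma_finite_measure.density_unique2[OF sigma_finite_lborel])
    fix A :: "real set" assume "A \<in> sets lborel"
    then have A[measurable]: "A \<in> sets borel" by simp
    have pre[measurable]: "{t\<in>P' i. ?t t \<in> A} \<in> sets borel"
      using sets.Int[of "P' i" borel "?t -` A \<inter> space borel"] by (simp add: Int_def)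
    have "(\<integral>\<^sup>+ s\<in>A. ennreal (\<rho> i s) \<partial>lborel) = emeasure (m.marg i) A"
      unfolding m.marg_def by (rule emeasure_density[symmetric]) auto
    also have "\<dots> = emeasure \<mu> ((\<lambda>x. x $ i) -` A \<inter> space \<mu>)"
      unfolding m.distr_coord[symmetric] by (rule emeasure_distr) (auto simp: m.measurable_coord)
    also have "\<dots> = emeasure \<mu>' (T -` ((\<lambda>x. x $ i) -` A \<inter> space \<mu>) \<inter> space \<mu>')"
      using emeasure_distr[OF measurable_T measurable_sets[OF m.measurable_coord[of i] A]] distr_T by simp
    also have "T -` ((\<lambda>x. x $ i) -` A \<inter> space \<mu>) \<inter> space \<mu>' = (\<lambda>x. x $ i) -` {t\<in>P' i. ?t t \<in> A} \<inter> space \<mu>'"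
    proof -
      have "T x \<in> \<Omega>" if "x \<in> \<Omega>'" for x using homeo that by (auto simp: homeomorphism_def)
      then show ?thesis by (auto simp: m.space_\<mu> m'.space_\<mu> T_nth)
    qed
    also have "emeasure \<mu>' \<dots> = emeasure (m'.marg i) {t\<in>P' i. ?t t \<in> A}"
      unfolding m'.distr_coord[symmetric] by (rule emeasure_distr[OF m'.measurable_coord pre, symmetric])
    also have "\<dots> = (\<integral>\<^sup>+ t. ennreal (\<rho>' i t) * indicator {t\<in>P' i. ?t t \<in> A} t \<partial>lborel)"
      unfolding m'.marg_def by (rule emeasure_density) auto
    also have "\<dots> = (\<integral>\<^sup>+ t. ennreal (indicator (P' i) t) * (ennreal (\<rho>' i t) * indicator A (?t t)) \<partial>lborel)"
      by (rule nn_integral_cong) (auto simp: indicator_def)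
    also have "\<dots> = (\<integral>\<^sup>+ t. ennreal (\<rho>' i t) * indicator A (?t t) \<partial>density lborel (\<lambda>t. ennreal (indicator (P' i) t)))"
      by (rule nn_integral_density[symmetric]) measurable
    also have "\<dots> = (\<integral>\<^sup>+ s. ennreal (?ds s) * (ennreal (\<rho>' i (?s s)) * indicator A (?t (?s s))) \<partial>lborel)"
      unfolding cov[symmetric] by (subst nn_integral_distr) (auto simp: nn_integral_density)
    also have "\<dots> = (\<integral>\<^sup>+ s\<in>A. ennreal (?ds s * \<rho>' i (?s s)) \<partial>lborel)"
    proof (rule nn_integral_cong)
      fix s
      have "\<sigma> i s \<in> P' i" "\<tau> i (\<sigma> i s) = s" if "s \<in> P i" using that s.img \<tau>_\<sigma> by blast+
      then show "ennreal (?ds s) * (ennreal (\<rho>' i (?s s)) * indicator A (?t (?s s)))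
          = ennreal (?ds s * \<rho>' i (?s s)) * indicator A s"
        using s.pos[of s i] m'.\<rho>_nonneg by (cases "s \<in> P i") (auto simp: ennreal_mult mult.assoc)
    qed
    finally show "(\<integral>\<^sup>+ s\<in>A. ennreal (\<rho> i s) \<partial>lborel) = (\<integral>\<^sup>+ s\<in>A. ennreal (?ds s * \<rho>' i (?s s)) \<partial>lborel)" .
  qed auto
  then show ?thesis
  proof eventually_elim
    case (elim s)
    then show ?case
      using s.pos[of s i] m.\<rho>_nonneg[of i s] m'.\<rho>_nonneg[of i "\<sigma> i s"] by (auto simp: mult.commute)
  qed
qed

lemma nataf_diag_nth: "nataf_diag \<mu>' \<rho>' \<mu> \<rho> x $ i $ i = deriv (\<tau> i) (\<sigma> i (x $ i))"
  by (simp add: nataf_diag_def)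

lemma nataf_diag_mult: "nataf_diag \<mu>' \<rho>' \<mu> \<rho> x *v v = (\<chi> i. deriv (\<tau> i) (\<sigma> i (x $ i)) * v $ i)"
  by (simp add: nataf_diag_def matrix_vector_mult_def vec_eq_iff if_distrib[of "\<lambda>a. a * _"] cong: if_cong)

lemma nataf_diag_density:
  "AE x in \<mu>. deriv (\<tau> i) (\<sigma> i (x $ i)) = \<rho>' i (\<sigma> i (x $ i)) / \<rho> i (x $ i)"
proof -
  let ?Q = "\<lambda>s. s \<in> P i \<longrightarrow> \<rho> i s = \<rho>' i (\<sigma> i s) * deriv (\<sigma> i) s"
  have "AE s in m.marg i. ?Q s"
    unfolding m.marg_def using marginal_density_transport[of i] by (subst AE_density) auto
  then have "AE s in distr \<mu> borel (\<lambda>x. x $ i). ?Q s" unfolding m.distr_coord .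
  from AE_distrD[OF m.measurable_coord this] AE_space show ?thesis
  proof eventually_elim
    case (elim x)
    then have x: "x \<in> \<Omega>" by (simp add: m.space_\<mu>)
    then have 1: "\<rho> i (x $ i) = \<rho>' i (\<sigma> i (x $ i)) * deriv (\<sigma> i) (x $ i)" using elim(1) by blast
    have "deriv (\<tau> i) (\<sigma> i (x $ i)) * deriv (\<sigma> i) (x $ i) = 1" using x by (intro coordinatewise_diffeo.\<tau>'_\<sigma>'[OF coordinatewise_diffeo]) blast
    then have "deriv (\<tau> i) (\<sigma> i (x $ i)) * \<rho> i (x $ i) = \<rho>' i (\<sigma> i (x $ i))"
      unfolding 1 by (simp add: mult.left_commute)
    moreover have "0 < \<rho> i (x $ i)" using m.coord_mem_I[OF x] by simp
    ultimately show ?case by (simp add: field_simps)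
  qed
qed

lemma nataf_diag_formulas:
  "AE x in \<mu>.
     nataf_diag \<mu>' \<rho>' \<mu> \<rho> x $ i $ i =
       ((\<lambda>t. \<rho>' i t / \<rho> i (marginal_cdf_inv \<mu> \<rho> i (marginal_cdf \<mu>' i t))) \<circ> \<sigma> i) (x $ i) \<and>
     nataf_diag \<mu>' \<rho>' \<mu> \<rho> x $ i $ i = \<rho>' i (\<sigma> i (x $ i)) / \<rho> i (x $ i)"
  using nataf_diag_density[of i] AE_space
proof eventually_elim
  case (elim x)
  then have "\<tau> i (\<sigma> i (x $ i)) = x $ i" by (intro \<tau>_\<sigma>) (auto simp: m.space_\<mu>)
  then have "marginal_cdf_inv \<mu> \<rho> i (marginal_cdf \<mu>' i (\<sigma> i (x $ i))) = x $ i"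
    by (simp add: nataf_coord_def)
  with elim show ?case by (simp add: nataf_diag_nth)
qed

text \<open>The inequality of \<open>\<mu>'\<close> is applied to \<open>f \<circ> T\<close>, whose weak gradient at \<open>x\<close> is \<open>D\<close> times that of \<open>f\<close>,
  evaluated at \<open>T x\<close>; all integrals are then moved to \<open>\<mu>\<close> along \<open>T\<close>.\<close>

lemma weighted_poincare_transport:
  assumes poincare: "weighted_poincare \<Omega>' \<mu>' W' C" and f: "in_L2 \<mu> f" and fg: "has_weak_gradient \<Omega> f g"
    and int: "integrable \<mu> (\<lambda>x. (matrix_norm (W' (S x)) (nataf_diag \<mu>' \<rho>' \<mu> \<rho> x *v g x))\<^sup>2)"
  shows "Var \<mu> f \<le> C * (\<integral>x. (matrix_norm (W' (S x)) (nataf_diag \<mu>' \<rho>' \<mu> \<rho> x *v g x))\<^sup>2 \<partial>\<mu>)"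
proof -
  let ?E = "\<lambda>x. (matrix_norm (W' (S x)) (nataf_diag \<mu>' \<rho>' \<mu> \<rho> x *v g x))\<^sup>2"
  let ?g = "\<lambda>x. \<chi> i. deriv (\<tau> i) (x $ i) * g (T x) $ i"
  let ?E' = "\<lambda>x. (matrix_norm (W' x) (?g x))\<^sup>2"
  have T_eq: "T = (\<lambda>x. \<chi> i. \<tau> i (x $ i))" by (auto simp: nataf_def)
  have transfer: "integral\<^sup>L \<mu>' (\<lambda>x. h (T x)) = integral\<^sup>L \<mu> h" if "h \<in> borel_measurable \<mu>" for h :: "real^'n \<Rightarrow> real"
    using integral_distr[OF measurable_T that] by (simp add: distr_T)
  have transfer_int: "integrable \<mu>' (\<lambda>x. h (T x))" if "integrable \<mu> h" for h :: "real^'n \<Rightarrow> real"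
    using integrable_distr[OF measurable_T, of h] that by (simp add: distr_T)
  have f_meas: "f \<in> borel_measurable \<mu>" and f_sq: "integrable \<mu> (\<lambda>x. (f x)\<^sup>2)"
    using f by (auto simp: in_L2_def)
  have E_eq: "?E (T x) = ?E' x" if "x \<in> space \<mu>'" for x
  proof -
    have x: "x \<in> \<Omega>'" using that by (simp add: m'.space_\<mu>)
    then have "S (T x) = x" using homeo by (simp add: homeomorphism_def)
    moreover have "\<sigma> i (T x $ i) = x $ i" for i using x by (simp add: T_nth \<sigma>_\<tau>)
    ultimately show ?thesis by (simp add: nataf_diag_mult)
  qed
  have "integrable \<mu>' ?E'"
    using transfer_int[OF int] by (rule Bochner_Integration.integrable_cong[THEN iffD1, OF refl, rotated]) (rule E_eq)
  moreover have "in_L2 \<mu>' (\<lambda>x. f (T x))"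
    using f_meas measurable_T transfer_int[OF f_sq] by (simp add: in_L2_def)
  moreover have "has_weak_gradient \<Omega>' (\<lambda>x. f (T x)) ?g"
    using coordinatewise_diffeo.has_weak_gradient_compose[OF coordinatewise_diffeo fg] by (simp add: T_eq)
  ultimately have "Var \<mu>' (\<lambda>x. f (T x)) \<le> C * integral\<^sup>L \<mu>' ?E'"
    using poincare by (simp add: weighted_poincare_def)
  also have "integral\<^sup>L \<mu>' ?E' = integral\<^sup>L \<mu>' (\<lambda>x. ?E (T x))"
    by (rule Bochner_Integration.integral_cong) (simp_all add: E_eq)
  also have "\<dots> = integral\<^sup>L \<mu> ?E" by (rule transfer) (use int in \<open>rule borel_measurable_integrable\<close>)
  also have "Var \<mu>' (\<lambda>x. f (T x)) = Var \<mu> f"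
    using transfer[OF f_meas] transfer[OF borel_measurable_integrable[OF f_sq]] by (simp add: Var_def)
  finally show ?thesis .
qed

end

text \<open>The infimum need not itself be admissible, but the inequality is linear in the constant.\<close>

lemma le_poincare_const_mult:
  assumes "weighted_poincare \<Omega> \<mu> W C0" "0 \<le> (e :: real)"
    and le: "\<And>C. weighted_poincare \<Omega> \<mu> W C \<Longrightarrow> v \<le> C * e"
  shows "v \<le> poincare_const \<Omega> \<mu> W * e"
proof (cases "e = 0")
  case True
  then show ?thesis using le[OF assms(1)] by simp
next
  case False
  with assms(2) have e: "0 < e" by simp
  have "v / e \<le> poincare_const \<Omega> \<mu> W"
    unfolding poincare_const_def
    by (rule cInf_greatest) (use assms(1) le e in \<open>auto simp: pos_divide_le_eq\<close>)
  then show ?thesis using e by (simp add: pos_divide_le_eq)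
qed

theorem proposition5p1:
  fixes \<Omega> \<Omega>' :: "(real^'n) set"
    and \<mu> \<mu>' :: "(real^'n) measure"
    and \<rho> \<rho>' :: "'n \<Rightarrow> real \<Rightarrow> real"
    and W' :: "real^'n \<Rightarrow> real^'n^'n"
  assumes "open \<Omega>" "connected \<Omega>" "piecewise_C1_boundary \<Omega>"
    and "open \<Omega>'" "connected \<Omega>'" "piecewise_C1_boundary \<Omega>'"
    and "prob_with_positive_density \<Omega> \<mu>"
    and "prob_with_positive_density \<Omega>' \<mu>'"
    and "same_copula \<mu> \<mu>'"
    and "marginal_densities \<mu> \<rho>"
    and "marginal_densities \<mu>' \<rho>'"
    and "diffeomorphism_with_inverse \<Omega>' \<Omega> (nataf \<mu>' \<mu> \<rho>) (nataf \<mu> \<mu>' \<rho>')"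
    and "weight_on \<Omega>' W'"
    and "\<exists>C. weighted_poincare \<Omega>' \<mu>' W' C"
  shows "(\<forall>f g. in_L2 \<mu> f \<and> has_weak_gradient \<Omega> f g \<and>
            integrable \<mu> (\<lambda>x. (matrix_norm (W' (nataf \<mu> \<mu>' \<rho>' x)) (nataf_diag \<mu>' \<rho>' \<mu> \<rho> x *v g x))\<^sup>2) \<longrightarrow>
            Var \<mu> f \<le> poincare_const \<Omega>' \<mu>' W' *
              (\<integral>x. (matrix_norm (W' (nataf \<mu> \<mu>' \<rho>' x)) (nataf_diag \<mu>' \<rho>' \<mu> \<rho> x *v g x))\<^sup>2 \<partial>\<mu>)) \<and>
         (\<forall>i. AE x in \<mu>.
            nataf_diag \<mu>' \<rho>' \<mu> \<rho> x $ i $ i =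
              ((\<lambda>t. \<rho>' i t / \<rho> i (marginal_cdf_inv \<mu> \<rho> i (marginal_cdf \<mu>' i t))) \<circ> nataf_coord \<mu> \<mu>' \<rho>' i) (x $ i) \<and>
            nataf_diag \<mu>' \<rho>' \<mu> \<rho> x $ i $ i = \<rho>' i (nataf_coord \<mu> \<mu>' \<rho>' i (x $ i)) / \<rho> i (x $ i))"
proof -
  interpret nataf_transport \<Omega> \<Omega>' \<mu> \<mu>' \<rho> \<rho>'
    by (intro nataf_transport.intro positive_density.intro nataf_transport_axioms.intro assms)
  obtain C0 where C0: "weighted_poincare \<Omega>' \<mu>' W' C0" using assms(14) by blast
  show ?thesis
  proof (intro conjI allI impI nataf_diag_formulas)
    fix f g
    assume fg: "in_L2 \<mu> f \<and> has_weak_gradient \<Omega> f g \<and>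
      integrable \<mu> (\<lambda>x. (matrix_norm (W' (S x)) (nataf_diag \<mu>' \<rho>' \<mu> \<rho> x *v g x))\<^sup>2)"
    show "Var \<mu> f \<le> poincare_const \<Omega>' \<mu>' W' *
      (\<integral>x. (matrix_norm (W' (S x)) (nataf_diag \<mu>' \<rho>' \<mu> \<rho> x *v g x))\<^sup>2 \<partial>\<mu>)"
      by (rule le_poincare_const_mult[OF C0]) (use fg in \<open>auto intro: weighted_poincare_transport\<close>)
  qed
qed

end
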